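(* Let $0\le m\le n$ with $m\in\mathbb{Z}$ and $n\in\mathbb{N}$, $n\geq 1$, and let $X$ be any metric space. Let $A\subset\mathbb{R}^n$ be Lebesgue measurable and let $f:A\to X$ be Lipschitz. Let $\operatorname{Crit}_m(f)$ be the set of all $x\in A$ at which $f$ is approximately metrically differentiable and $\operatorname{rank}\,\mathrm{md}_a(f,x)<m$. Then $$\mathcal{H}^{n-m}\big(f^{-1}(z)\cap\operatorname{Crit}_m(f)\big)=0\qquad\text{for }\mathcal{H}^m\text{-almost all }z\in X.$$
   Context: A seminorm on $\mathbb{R}^n$ is a function $\sigma:\mathbb{R}^n\to[0,\infty)$ with $\sigma(\lambda v)=|\lambda|\sigma(v)$ and $\sigma(v+w)\le\sigma(v)+\sigma(w)$. Its rank is $\operatorname{rank}\sigma=n-\dim\{v:\sigma(v)=0\}$. A measurable map $f:A\to(X,d)$ on a measurable set $A\subset\mathbb{R}^n$ is approximately metrically differentiable at $x\in A$ if there are a measurable set $A_x\subset A$ having $x$ as a Lebesgue density point and a seminorm $\sigma_x$ on $\mathbb{R}^n$ such that $$\lim_{A_x\ni y\to x}\frac{d(f(y),f(x))-\sigma_x(y-x)}{|y-x|}=0;$$ $\sigma_x$ is then unique and is denoted $\mathrm{md}_a(f,x)$. (For Lipschitz $f$ it exists at almost every $x\in A$, by Kirchheim's theorem.) $\mathcal{H}^s$ is the $s$-dimensional Hausdorff measure; $\mathcal{H}^0$ is the counting measure. *)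

theory Defs
  imports "HOL-Analysis.Analysis"
begin

section \<open>Hausdorff measure\<close>

text \<open>
  Contribution of one covering set: \<open>\<omega>\<^sub>s (diam U / 2)\<^sup>s\<close>, with the conventions that the empty set
  contributes \<open>0\<close> for every \<open>s\<close> and a nonempty set contributes \<open>1\<close> for \<open>s = 0\<close>
  (in the library \<open>0 powr 0 = 0\<close>, so points would otherwise have \<open>\<H>\<^sup>0\<close>-measure zero).
\<close>
definition hausdorff_gauge :: "real \<Rightarrow> 'a::metric_space set \<Rightarrow> ennreal" where
  "hausdorff_gauge s U =
     (if U = {} then 0
      else if s = 0 then 1
      else ennreal (unit_ball_vol s * (diameter U / 2) powr s))"

text \<open>
  Boundedness of the covering sets is explicit because \<^const>\<open>diameter\<close> is real-valued and
  carries no information on unbounded sets. If there is no admissible cover, the infimum is \<open>\<infinity>\<close>.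
\<close>
definition hausdorff_pre_measure :: "real \<Rightarrow> real \<Rightarrow> 'a::metric_space set \<Rightarrow> ennreal" where
  "hausdorff_pre_measure s \<delta> E =
     (INF U \<in> {U :: nat \<Rightarrow> 'a set. E \<subseteq> (\<Union>i. U i) \<and> (\<forall>i. bounded (U i) \<and> diameter (U i) \<le> \<delta>)}.
        \<Sum>i. hausdorff_gauge s (U i))"

text \<open>The Hausdorff (outer) measure of dimension \<open>s \<ge> 0\<close>, defined on arbitrary subsets.\<close>
definition hausdorff_measure :: "real \<Rightarrow> 'a::metric_space set \<Rightarrow> ennreal" where
  "hausdorff_measure s E = (SUP \<delta> \<in> {0<..}. hausdorff_pre_measure s \<delta> E)"

lemma hausdorff_measure_mono:
  "E \<subseteq> F \<Longrightarrow> hausdorff_measure s E \<le> hausdorff_measure s F"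
  unfolding hausdorff_measure_def hausdorff_pre_measure_def
  by (intro SUP_mono' INF_superset_mono) auto

lemma hausdorff_measure_0_ge_card:
  fixes E :: "'a::metric_space set"
  assumes "finite E"
  shows "of_nat (card E) \<le> hausdorff_measure 0 E"
proof -
  obtain \<delta> where \<delta>: "\<delta> > 0" "\<And>x y. x \<in> E \<Longrightarrow> y \<in> E \<Longrightarrow> x \<noteq> y \<Longrightarrow> \<delta> < dist x y"
  proof -
    define D where "D = insert 1 ((\<lambda>(x,y). dist x y) ` {(x,y) \<in> E \<times> E. x \<noteq> y})"
    have "finite {(x,y) \<in> E \<times> E. x \<noteq> y}"
      by (rule finite_subset[of _ "E \<times> E"]) (use assms in auto)
    then have fin: "finite D" "D \<noteq> {}"
      by (auto simp: D_def)
    have pos: "Min D > 0"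
      using fin by (subst Min_gr_iff) (auto simp: D_def)
    show ?thesis
    proof (rule that[of "Min D / 2"])
      fix x y assume "x \<in> E" "y \<in> E" "x \<noteq> y"
      then have "dist x y \<in> D"
        by (force simp: D_def)
      then have "Min D \<le> dist x y"
        using fin by simp
      then show "Min D / 2 < dist x y"
        using pos by simp
    qed (use pos in simp)
  qed
  have "of_nat (card E) \<le> hausdorff_pre_measure 0 \<delta> E"
    unfolding hausdorff_pre_measure_def
  proof (rule INF_greatest)
    fix U :: "nat \<Rightarrow> 'a set"
    assume "U \<in> {U. E \<subseteq> (\<Union>i. U i) \<and> (\<forall>i. bounded (U i) \<and> diameter (U i) \<le> \<delta>)}"
    then have U: "E \<subseteq> (\<Union>i. U i)" "\<And>i. bounded (U i)" "\<And>i. diameter (U i) \<le> \<delta>"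
      by auto
    then have "\<forall>x\<in>E. \<exists>i. x \<in> U i"
      by auto
    then obtain k where k: "\<And>x. x \<in> E \<Longrightarrow> x \<in> U (k x)"
      by metis
    have inj: "inj_on k E"
    proof (rule inj_onI, rule ccontr)
      fix x y assume xy: "x \<in> E" "y \<in> E" "k x = k y" "x \<noteq> y"
      then have "dist x y \<le> diameter (U (k x))"
        using U(2) k[OF xy(1)] k[OF xy(2)] by (intro diameter_bounded_bound) auto
      with U(3)[of "k x"] \<delta>(2)[OF xy(1,2,4)] show False
        by simp
    qed
    have "of_nat (card E) = (\<Sum>i\<in>k ` E. 1::ennreal)"
      by (simp add: card_image inj)
    also have "\<dots> = (\<Sum>i\<in>k ` E. hausdorff_gauge 0 (U i))"
      using k by (intro sum.cong) (auto simp: hausdorff_gauge_def)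
    also have "\<dots> \<le> (\<Sum>i. hausdorff_gauge 0 (U i))"
      using assms by (intro sum_le_suminf) auto
    finally show "of_nat (card E) \<le> (\<Sum>i. hausdorff_gauge 0 (U i))" .
  qed
  also have "\<dots> \<le> hausdorff_measure 0 E"
    unfolding hausdorff_measure_def using \<delta>(1) by (intro SUP_upper) auto
  finally show ?thesis .
qed

lemma hausdorff_measure_0_eq_counting:
  fixes E :: "'a::metric_space set"
  shows "hausdorff_measure 0 E = emeasure (count_space UNIV) E"
proof (cases "finite E")
  case True
  then obtain g :: "nat \<Rightarrow> 'a" where g: "E = g ` {..<card E}"
    by (metis finite_imp_nat_seg_image_inj_on card_Collect_less_nat card_image lessThan_def)
  define U where "U i = (if i < card E then {g i} else {})" for i
  have "hausdorff_measure 0 E \<le> of_nat (card E)"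
    unfolding hausdorff_measure_def
  proof (rule SUP_least)
    fix \<delta> :: real assume "\<delta> \<in> {0<..}"
    then have "hausdorff_pre_measure 0 \<delta> E \<le> (\<Sum>i. hausdorff_gauge 0 (U i))"
      unfolding hausdorff_pre_measure_def
      by (intro INF_lower) (subst g, auto simp: U_def)
    also have "\<dots> = (\<Sum>i<card E. hausdorff_gauge 0 (U i))"
      by (intro suminf_finite) (auto simp: U_def hausdorff_gauge_def)
    also have "\<dots> = of_nat (card E)"
      by (simp add: U_def hausdorff_gauge_def)
    finally show "hausdorff_pre_measure 0 \<delta> E \<le> of_nat (card E)" .
  qed
  with hausdorff_measure_0_ge_card[OF True] True show ?thesis
    by (simp add: emeasure_count_space)
next
  case False
  have "of_nat n \<le> hausdorff_measure 0 E" for n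
  proof -
    obtain F where F: "finite F" "card F = n" "F \<subseteq> E"
      using infinite_arbitrarily_large[OF False] by metis
    then show ?thesis
      using hausdorff_measure_0_ge_card[OF F(1)] hausdorff_measure_mono[OF F(3), of 0] by auto
  qed
  then have "hausdorff_measure 0 E = top"
    using ennreal_Ex_less_of_nat leD top.not_eq_extremum by metis
  with False show ?thesis
    by (simp add: emeasure_count_space)
qed


section \<open>Approximate metric differentiability\<close>

definition seminorm :: "('a::real_vector \<Rightarrow> real) \<Rightarrow> bool" where
  "seminorm \<sigma> \<longleftrightarrow>
     (\<forall>v. 0 \<le> \<sigma> v) \<and>
     (\<forall>c v. \<sigma> (c *\<^sub>R v) = \<bar>c\<bar> * \<sigma> v) \<and>
     (\<forall>v w. \<sigma> (v + w) \<le> \<sigma> v + \<sigma> w)"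

definition seminorm_rank :: "('a::euclidean_space \<Rightarrow> real) \<Rightarrow> nat" where
  "seminorm_rank \<sigma> = DIM('a) - dim {v. \<sigma> v = 0}"

definition lebesgue_density_point :: "'a::euclidean_space set \<Rightarrow> 'a \<Rightarrow> bool" where
  "lebesgue_density_point S x \<longleftrightarrow>
     ((\<lambda>r. measure lebesgue (S \<inter> ball x r) / measure lebesgue (ball x r)) \<longlongrightarrow> 1) (at_right 0)"

text \<open>A map \<open>f : A \<rightarrow> X\<close> is represented by a total function; only its values on \<open>A\<close> are used.\<close>
definition has_approx_metric_derivative ::
    "('a::euclidean_space \<Rightarrow> 'b::metric_space) \<Rightarrow> 'a set \<Rightarrow> 'a \<Rightarrow> ('a \<Rightarrow> real) \<Rightarrow> bool" where
  "has_approx_metric_derivative f A x \<sigma> \<longleftrightarrow>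
     seminorm \<sigma> \<and>
     (\<exists>S \<in> sets lebesgue. S \<subseteq> A \<and> lebesgue_density_point S x \<and>
        ((\<lambda>y. (dist (f y) (f x) - \<sigma> (y - x)) / norm (y - x)) \<longlongrightarrow> 0) (at x within S))"

definition approx_metrically_differentiable ::
    "('a::euclidean_space \<Rightarrow> 'b::metric_space) \<Rightarrow> 'a set \<Rightarrow> 'a \<Rightarrow> bool" where
  "approx_metrically_differentiable f A x \<longleftrightarrow>
     x \<in> A \<and> (\<exists>\<sigma>. has_approx_metric_derivative f A x \<sigma>)"

text \<open>Only meaningful where the derivative exists; there the seminorm is unique.\<close>
definition approx_metric_derivative ::
    "('a::euclidean_space \<Rightarrow> 'b::metric_space) \<Rightarrow> 'a set \<Rightarrow> 'a \<Rightarrow> 'a \<Rightarrow> real" where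
  "approx_metric_derivative f A x = (THE \<sigma>. has_approx_metric_derivative f A x \<sigma>)"

definition Crit ::
    "nat \<Rightarrow> ('a::euclidean_space \<Rightarrow> 'b::metric_space) \<Rightarrow> 'a set \<Rightarrow> 'a set" where
  "Crit m f A =
     {x \<in> A. approx_metrically_differentiable f A x \<and>
             seminorm_rank (approx_metric_derivative f A x) < m}"

end

theory Submission
  imports Defs
begin

text \<open>
  Write \<open>n = k + m\<close> for the dimension of the domain. The case \<open>m = 0\<close> is trivial, because no rank
  is negative. For \<open>m > 0\<close>, a countable cover of a set \<open>E\<close> by sets \<open>U\<^sub>i\<close> is charged the cost
  \<open>\<Sum>\<^sub>i (diam U\<^sub>i)\<^sup>k (diam f(U\<^sub>i))\<^sup>m\<close>. The proof shows that the critical set has covers by arbitrarily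
  small sets of arbitrarily small cost, and that this forces almost all fibres to be null.

  \<^bold>\<open>From cheap covers to null fibres.\<close> A point \<open>z\<close> whose fibre in \<open>E\<close> has \<open>k\<close>-dimensional
  premeasure above \<open>t\<close> satisfies \<open>\<Sum> (diam U\<^sub>i)\<^sup>k > const * t\<close>, the sum being over those \<open>i\<close> with
  \<open>z \<in> f(U\<^sub>i)\<close>. So the sets \<open>f(U\<^sub>i)\<close> form a weighted cover of the set of these \<open>z\<close>. Its cost bounds
  a weighted \<open>m\<close>-dimensional premeasure only, and the weights must be removed. This is done by a
  fractional form of the Vitali selection (\<open>weighted_cover_selection\<close>): going through the sets by
  decreasing diameter, the \<open>i\<close>-th set receives a subset \<open>T\<^sub>i\<close> of \<open>[0,1]\<close>, of measure its weight if
  there is room, disjoint from the \<open>T\<^sub>j\<close> of all earlier sets that it meets. For each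
  \<open>\<tau> \<in> [0,1]\<close> the sets with \<open>\<tau> \<in> T\<^sub>i\<close>, suitably enlarged, cover; averaging over \<open>\<tau>\<close> yields one
  \<open>\<tau>\<close> for which their cost is at most the weighted cost.

  \<^bold>\<open>Cheap covers of the critical set.\<close> By the Lipschitz condition and the density of \<open>A\<^sub>x\<close> at \<open>x\<close>,
  the first order expansion of \<open>dist (f y) (f x)\<close> holds for all \<open>y \<in> A\<close> near \<open>x\<close>. If
  \<open>\<sigma>\<close> is the derivative at \<open>x\<close>, then \<open>f\<close> maps the slab of those \<open>y\<close> in the ball of radius \<open>r\<close>
  about \<open>x\<close> with \<open>\<sigma>(y - x) \<le> \<epsilon> r\<close> into a set of diameter at most \<open>4 \<epsilon> r\<close>. As \<open>\<sigma>\<close> has rank at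
  most \<open>m - 1\<close>, the slab has volume at least \<open>const * \<epsilon>\<^sup>m\<^sup>-\<^sup>1 r\<^sup>n\<close> (\<open>slab_volume_ge\<close>), while its cost is
  at most \<open>const * r\<^sup>k (\<epsilon> r)\<^sup>m\<close>, which is \<open>const * \<epsilon>\<close> times that volume (\<open>critical_slab\<close>). On the
  other hand every subset of \<open>A\<close> has cost at most a constant times the volume of any open
  neighbourhood (\<open>coarea_cover_le_volume\<close>). A covering argument that repeatedly
  removes disjoint slabs turns the cost-to-volume ratio of the slabs into that of the whole critical
  set (\<open>cover_measure_le_volume\<close>). Now \<open>\<epsilon>\<close> tends to \<open>0\<close>.

  In the volume estimate the constants depend on a bound \<open>K\<close> with \<open>\<sigma> v \<le> K * norm v\<close>; so the
  critical set is first split into countably many bounded pieces with a common \<open>K\<close>.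
\<close>

section \<open>Countable covers with a set gauge\<close>

text \<open>
  The Method I construction of an outer measure. It serves both for the Hausdorff premeasures and
  for the cost of covers in the domain of the map, so that subadditivity is proved once.
\<close>
definition cover_measure :: "('a set \<Rightarrow> ennreal) \<Rightarrow> 'a set \<Rightarrow> ennreal" where
  "cover_measure g E = (INF U \<in> {U :: nat \<Rightarrow> 'a set. E \<subseteq> (\<Union>i. U i)}. \<Sum>i. g (U i))"

lemma cover_measure_mono:
  "E \<subseteq> F \<Longrightarrow> cover_measure g E \<le> cover_measure g F"
  unfolding cover_measure_def by (intro INF_superset_mono) auto

lemma cover_measure_le_gauge:
  assumes "g {} = 0"
  shows "cover_measure g E \<le> g E"
proof -
  define U :: "nat \<Rightarrow> 'a set" where "U i = (if i = 0 then E else {})" for i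
  have "cover_measure g E \<le> (\<Sum>i. g (U i))"
    unfolding cover_measure_def by (rule INF_lower) (auto simp: U_def)
  also have "\<dots> = (\<Sum>i<1. g (U i))"
    by (rule suminf_finite) (auto simp: U_def assms)
  finally show ?thesis
    by (simp add: U_def)
qed

lemma cover_measure_less_obtain:
  assumes "cover_measure g E < b"
  obtains U :: "nat \<Rightarrow> 'a set" where "E \<subseteq> (\<Union>i. U i)" "(\<Sum>i. g (U i)) < b"
  using assms unfolding cover_measure_def INF_less_iff by auto

lemma cover_measure_UN_nat:
  fixes E :: "nat \<Rightarrow> 'a set"
  shows "cover_measure g (\<Union>i. E i) \<le> (\<Sum>i. cover_measure g (E i))"
proof (rule ennreal_le_epsilon)
  fix e :: real assume e: "0 < e" and fin: "(\<Sum>i. cover_measure g (E i)) < top"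
  have lt: "cover_measure g (E i) < cover_measure g (E i) + ennreal (e * (1/2) ^ Suc i)" for i
  proof -
    have "cover_measure g (E i) \<le> (\<Sum>i. cover_measure g (E i))"
      using sum_le_suminf[of "\<lambda>i. cover_measure g (E i)" "{i}"] by simp
    then have "cover_measure g (E i) \<noteq> top"
      using fin by (auto simp: top_unique)
    then show ?thesis
      using e by (simp add: ennreal_add_left_cancel_less[of _ 0, simplified])
  qed
  have "\<exists>U. E i \<subseteq> (\<Union>j. U j) \<and> (\<Sum>j. g (U j)) < cover_measure g (E i) + ennreal (e * (1/2) ^ Suc i)" for i
    by (rule cover_measure_less_obtain[OF lt[of i]]) blast
  then obtain U where U: "\<And>i. E i \<subseteq> (\<Union>j. U i j)"
      "\<And>i. (\<Sum>j. g (U i j)) < cover_measure g (E i) + ennreal (e * (1/2) ^ Suc i)"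
    by metis
  define W where "W p = (case p of (i, j) \<Rightarrow> U i j)" for p :: "nat \<times> nat"
  have "(\<Union>i. E i) \<subseteq> (\<Union>p. W (prod_decode p))"
  proof
    fix x assume "x \<in> (\<Union>i. E i)"
    then obtain i j where "x \<in> U i j"
      using U(1) by blast
    then have "x \<in> W (prod_decode (prod_encode (i, j)))"
      by (simp add: W_def)
    then show "x \<in> (\<Union>p. W (prod_decode p))"
      by blast
  qed
  then have "cover_measure g (\<Union>i. E i) \<le> (\<Sum>p. g (W (prod_decode p)))"
    unfolding cover_measure_def by (intro INF_lower) simp
  also have "\<dots> = (\<Sum>i. \<Sum>j. g (U i j))"
    by (rule suminf_ennreal_2dimen) (simp add: W_def)
  also have "\<dots> \<le> (\<Sum>i. cover_measure g (E i) + ennreal (e * (1/2) ^ Suc i))"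
    by (intro suminf_le less_imp_le U) auto
  also have "\<dots> = (\<Sum>i. cover_measure g (E i)) + (\<Sum>i. ennreal (e * (1/2) ^ Suc i))"
    by (simp add: suminf_add[symmetric])
  also have "(\<Sum>i. ennreal (e * (1/2) ^ Suc i)) = ennreal e"
    using e sums_mult[OF power_half_series, of e] by (intro suminf_ennreal_eq) auto
  finally show "cover_measure g (\<Union>i. E i) \<le> (\<Sum>i. cover_measure g (E i)) + ennreal e" .
qed

lemma cover_measure_UN_index:
  fixes I :: "nat set"
  assumes "g {} = 0"
  shows "cover_measure g (\<Union>i\<in>I. E i) \<le> (\<Sum>i. cover_measure g (E i) * indicator I i)"
proof -
  have empty: "cover_measure g {} = 0"
    using cover_measure_le_gauge[of g "{}"] assms by simp
  have eq: "(\<Union>i\<in>I. E i) = (\<Union>i. if i \<in> I then E i else {})"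
    by (auto split: if_splits)
  have "cover_measure g (\<Union>i\<in>I. E i) \<le> (\<Sum>i. cover_measure g (if i \<in> I then E i else {}))"
    unfolding eq by (rule cover_measure_UN_nat)
  also have "\<dots> = (\<Sum>i. cover_measure g (E i) * indicator I i)"
    by (intro suminf_cong) (auto simp: empty indicator_def)
  finally show ?thesis .
qed

lemma cover_measure_UN_finite:
  fixes F :: "nat set"
  assumes "g {} = 0" "finite F"
  shows "cover_measure g (\<Union>i\<in>F. E i) \<le> (\<Sum>i\<in>F. cover_measure g (E i))"
proof -
  have "cover_measure g (\<Union>i\<in>F. E i) \<le> (\<Sum>i. cover_measure g (E i) * indicator F i)"
    by (rule cover_measure_UN_index) (rule assms)
  also have "\<dots> = (\<Sum>i\<in>F. cover_measure g (E i) * indicator F i)"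
    by (rule suminf_finite) (auto simp: assms)
  finally show ?thesis
    by simp
qed

lemma cover_measure_Un:
  assumes "g {} = 0"
  shows "cover_measure g (E \<union> F) \<le> cover_measure g E + cover_measure g F"
  using cover_measure_UN_finite[where g = g and F = "{0, 1}" and E = "\<lambda>i. if i = 0 then E else F"]
    assms by (simp add: Un_commute)

lemma cover_measure_UN_null:
  fixes E :: "nat \<Rightarrow> 'a set"
  assumes "\<And>i. cover_measure g (E i) = 0"
  shows "cover_measure g (\<Union>i. E i) = 0"
  using cover_measure_UN_nat[of g E] assms by simp

section \<open>Null sets of Hausdorff measures\<close>

text \<open>
  The restriction to covers by small sets can be moved into the gauge: a single
  inadmissible set makes the whole sum infinite.
\<close>
lemma hausdorff_pre_measure_eq_cover_measure:
  "hausdorff_pre_measure s \<delta> E =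
     cover_measure (\<lambda>U. if bounded U \<and> diameter U \<le> \<delta> then hausdorff_gauge s U else top) E"
    (is "_ = cover_measure ?g E")
  unfolding cover_measure_def hausdorff_pre_measure_def
proof (rule antisym)
  let ?A = "{U :: nat \<Rightarrow> 'a set. E \<subseteq> (\<Union>i. U i) \<and> (\<forall>i. bounded (U i) \<and> diameter (U i) \<le> \<delta>)}"
  let ?B = "{U :: nat \<Rightarrow> 'a set. E \<subseteq> (\<Union>i. U i)}"
  show "(INF U\<in>?A. \<Sum>i. hausdorff_gauge s (U i)) \<le> (INF U\<in>?B. \<Sum>i. ?g (U i))"
  proof (rule INF_greatest)
    fix U assume U: "U \<in> ?B"
    show "(INF U\<in>?A. \<Sum>i. hausdorff_gauge s (U i)) \<le> (\<Sum>i. ?g (U i))"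
    proof (cases "\<forall>i. bounded (U i) \<and> diameter (U i) \<le> \<delta>")
      case True
      then show ?thesis
        using U by (intro INF_lower2[of U]) auto
    next
      case False
      then obtain i where "\<not> (bounded (U i) \<and> diameter (U i) \<le> \<delta>)"
        by blast
      then have "top \<le> ?g (U i)"
        by (simp only: if_not_P) simp
      also have "?g (U i) \<le> (\<Sum>i. ?g (U i))"
        using sum_le_suminf[of "\<lambda>i. ?g (U i)" "{i}"] by simp
      finally have "(\<Sum>i. ?g (U i)) = top"
        by (rule top_unique[THEN iffD1])
      then show ?thesis
        by simp
    qed
  qed
  show "(INF U\<in>?B. \<Sum>i. ?g (U i)) \<le> (INF U\<in>?A. \<Sum>i. hausdorff_gauge s (U i))"
  proof (rule INF_greatest)
    fix U assume "U \<in> ?A"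
    then show "(INF U\<in>?B. \<Sum>i. ?g (U i)) \<le> (\<Sum>i. hausdorff_gauge s (U i))"
      by (intro INF_lower2[of U]) auto
  qed
qed

lemma hausdorff_measure_null_iff:
  "hausdorff_measure s E = 0 \<longleftrightarrow> (\<forall>\<delta>>0. hausdorff_pre_measure s \<delta> E = 0)"
proof -
  have "hausdorff_measure s E = 0 \<longleftrightarrow> hausdorff_measure s E \<le> 0"
    by simp
  also have "\<dots> \<longleftrightarrow> (\<forall>\<delta>>0. hausdorff_pre_measure s \<delta> E = 0)"
    unfolding hausdorff_measure_def SUP_le_iff by auto
  finally show ?thesis .
qed

lemma hausdorff_measure_UN_null:
  fixes E :: "nat \<Rightarrow> 'a::metric_space set"
  assumes "\<And>i. hausdorff_measure s (E i) = 0"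
  shows "hausdorff_measure s (\<Union>i. E i) = 0"
  using assms unfolding hausdorff_measure_null_iff hausdorff_pre_measure_eq_cover_measure
  by (auto intro!: cover_measure_UN_null)

lemma hausdorff_measure_null_subset:
  "hausdorff_measure s F = 0 \<Longrightarrow> E \<subseteq> F \<Longrightarrow> hausdorff_measure s E = 0"
  using hausdorff_measure_mono[of E F s] by simp

lemma hausdorff_pre_measure_antimono:
  assumes "\<delta> \<le> \<delta>'"
  shows "hausdorff_pre_measure s \<delta>' E \<le> hausdorff_pre_measure s \<delta> E"
  unfolding hausdorff_pre_measure_def
  by (rule INF_superset_mono) (use assms in \<open>auto intro: order_trans\<close>)

lemma hausdorff_pre_measure_le:
  assumes "E \<subseteq> (\<Union>i. U i)" "\<And>i. bounded (U i)" "\<And>i. diameter (U i) \<le> \<delta>"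
  shows "hausdorff_pre_measure s \<delta> E \<le> (\<Sum>i. hausdorff_gauge s (U i))"
  unfolding hausdorff_pre_measure_def by (rule INF_lower) (use assms in auto)

lemma hausdorff_measure_empty: "hausdorff_measure s ({} :: 'a::metric_space set) = 0"
  unfolding hausdorff_measure_null_iff
proof (intro allI impI)
  fix \<delta> :: real assume "0 < \<delta>"
  then have "hausdorff_pre_measure s \<delta> ({} :: 'a set) \<le> (\<Sum>i. hausdorff_gauge s ({} :: 'a set))"
    using hausdorff_pre_measure_le[of "{} :: 'a set" "\<lambda>_. {}" \<delta> s] by simp
  then show "hausdorff_pre_measure s \<delta> ({} :: 'a set) = 0"
    by (simp add: hausdorff_gauge_def)
qed

section \<open>Selecting from a weighted cover\<close>

text \<open>
  Lebesgue measure on the line has no atoms: the measure of \<open>S \<inter> {0..x}\<close> is a continuous function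
  of \<open>x\<close>, and the intermediate value theorem applies.
\<close>
lemma exists_subset_of_measure:
  fixes S :: "real set"
  assumes S: "S \<in> sets borel" "S \<subseteq> {0..1}" and c: "0 \<le> c"
  shows "\<exists>T. T \<in> sets borel \<and> T \<subseteq> S \<and> measure lborel T \<le> c \<and> (measure lborel T = c \<or> T = S)"
proof (cases "measure lborel S \<le> c")
  case True
  then show ?thesis
    using S by blast
next
  case False
  define F where "F x = measure lborel (S \<inter> {0..x})" for x :: real
  have fm: "S \<inter> B \<in> fmeasurable lborel" if "B \<in> sets borel" for B
  proof (rule fmeasurableI2[of "{0..1::real}"])
    show "{0..1::real} \<in> fmeasurable lborel"
      by (intro fmeasurableI) auto
  qed (use S that in auto)
  have step: "\<bar>F y - F x\<bar> \<le> y - x" if "x \<le> y" "0 \<le> x" for x y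
  proof -
    have "F x \<le> F y"
      unfolding F_def using S that by (intro measure_mono_fmeasurable fm) auto
    have iv: "{x..y} \<in> fmeasurable lborel"
      using fmeasurable_cbox[of x y] by simp
    have "F y \<le> measure lborel ((S \<inter> {0..x}) \<union> {x..y})"
      unfolding F_def
    proof (rule measure_mono_fmeasurable)
      show "(S \<inter> {0..x}) \<union> {x..y} \<in> fmeasurable lborel"
        by (intro fmeasurable.Un fm iv) auto
    qed (use that S in auto)
    also have "\<dots> \<le> F x + measure lborel {x..y}"
      unfolding F_def by (intro measure_Un_le) (use S in auto)
    also have "measure lborel {x..y} = y - x"
      using that by simp
    finally show ?thesis
      using \<open>F x \<le> F y\<close> by simp
  qed
  have "1-lipschitz_on {0..1} F"
  proof (rule lipschitz_onI)
    fix x y :: real assume "x \<in> {0..1}" "y \<in> {0..1}"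
    then show "dist (F x) (F y) \<le> 1 * dist x y"
      using step[of x y] step[of y x] by (cases "x \<le> y") (auto simp: dist_real_def)
  qed auto
  then have cont: "continuous_on {0..1} F"
    by (rule lipschitz_on_continuous_on)
  have "S \<inter> {0..0} \<subseteq> {0}"
    by auto
  then have "F 0 \<le> measure lborel {0::real}"
    unfolding F_def using S by (intro measure_mono_fmeasurable fmeasurableI) auto
  then have F0: "F 0 \<le> c"
    using c by simp
  have F1: "c \<le> F 1"
    using False S(2) by (simp add: F_def Int_absorb2)
  obtain x where "0 \<le> x" "x \<le> 1" "F x = c"
    using IVT'[OF F0 F1 _ cont] by auto
  then show ?thesis
    using S by (intro exI[of _ "S \<inter> {0..x}"]) (auto simp: F_def)
qed

text \<open>
  A Vitali selection for weighted covers. Think of \<open>R\<close> as the order by decreasing diameter and of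
  \<open>w i\<close> as the cost of \<open>V i\<close>. Each index \<open>i\<close> in turn is given a subset \<open>T i\<close> of \<open>{0..1}\<close> of measure
  \<open>c i\<close>, or all that is left, after removal of the sets \<open>T j\<close> of its predecessors with
  \<open>V j\<close> meeting \<open>V i\<close>. For a point \<open>z \<in> Z\<close> not all of the \<open>V i\<close> that contain \<open>z\<close> can
  receive their full share, as the shares would be disjoint subsets of \<open>{0..1}\<close> of total measure
  above \<open>1\<close>. So some \<open>V j\<close> with \<open>z \<in> V j\<close> took all that was left, which means that every
  \<open>\<tau> \<in> {0..1}\<close> lies in \<open>T j\<close> or in the set \<open>T i\<close> of a predecessor meeting \<open>V j\<close>. Hence
  \<open>J = {i. \<tau> \<in> T i}\<close> has the covering property for every \<open>\<tau>\<close>, and the average over \<open>\<tau>\<close> of its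
  total cost is at most the weighted cost.
\<close>
lemma weighted_cover_selection:
  fixes V :: "nat \<Rightarrow> 'b set" and c :: "nat \<Rightarrow> real" and w :: "nat \<Rightarrow> ennreal"
    and R :: "(nat \<times> nat) set"
  assumes wf: "wf R" and total: "\<And>i j. i \<noteq> j \<Longrightarrow> (i, j) \<in> R \<or> (j, i) \<in> R"
    and c: "\<And>i. 0 \<le> c i"
    and Z: "\<And>z. z \<in> Z \<Longrightarrow> 1 < (\<Sum>i. ennreal (c i) * indicator (V i) z)"
    and b: "(\<Sum>i. ennreal (c i) * w i) < b"
  shows "\<exists>J. (\<forall>z\<in>Z. \<exists>i\<in>J. \<exists>j. z \<in> V j \<and> V i \<inter> V j \<noteq> {} \<and> (i = j \<or> (i, j) \<in> R)) \<and>
    (\<Sum>i. w i * indicator J i) \<le> b"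
proof -
  define blocked where "blocked T i = (\<Union>j\<in>{j. (j, i) \<in> R \<and> V j \<inter> V i \<noteq> {}}. T j)"
    for T :: "nat \<Rightarrow> real set" and i
  define P where "P T i X \<longleftrightarrow> ((\<forall>j. (j, i) \<in> R \<longrightarrow> T j \<in> sets borel) \<longrightarrow>
      X \<in> sets borel \<and> X \<subseteq> {0..1} - blocked T i \<and> measure lborel X \<le> c i \<and>
      (measure lborel X = c i \<or> X = {0..1} - blocked T i))"
    for T :: "nat \<Rightarrow> real set" and i X
  \<comment> \<open>Well-founded recursion along \<open>R\<close>; measurability of the earlier sets is derived
    afterwards by induction, which is why \<open>P\<close> carries it as a premise.\<close>
  have "\<exists>T. \<forall>i. P T i (T i)"
  proof (rule dependent_wf_choice[OF wf])
    fix T T' :: "nat \<Rightarrow> real set" and i X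
    assume eq: "\<And>j. (j, i) \<in> R \<Longrightarrow> T j = T' j"
    then have "blocked T i = blocked T' i"
      by (auto simp: blocked_def)
    then show "P T i X = P T' i X"
      using eq by (auto simp: P_def)
  next
    fix i and T :: "nat \<Rightarrow> real set"
    assume "\<And>j. (j, i) \<in> R \<Longrightarrow> P T j (T j)"
    show "\<exists>X. P T i X"
    proof (cases "\<forall>j. (j, i) \<in> R \<longrightarrow> T j \<in> sets borel")
      case True
      then have "blocked T i \<in> sets borel"
        unfolding blocked_def by (intro sets.countable_UN'') auto
      then show ?thesis
        unfolding P_def using exists_subset_of_measure[OF _ _ c, of "{0..1} - blocked T i" i] by auto
    qed (auto simp: P_def)
  qed
  then obtain T where T: "\<And>i. P T i (T i)"
    by blast
  have T_borel: "T i \<in> sets borel" for i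
    using wf
  proof (induction i rule: wf_induct_rule)
    case (less i)
    then show ?case
      using T[of i] by (auto simp: P_def)
  qed
  then have T_sub: "T i \<subseteq> {0..1} - blocked T i"
    and T_le: "measure lborel (T i) \<le> c i"
    and T_full: "measure lborel (T i) = c i \<or> T i = {0..1} - blocked T i" for i
    using T[of i] by (auto simp: P_def)
  have T_fin: "T i \<in> fmeasurable lborel" for i
  proof (rule fmeasurableI2[of "{0..1::real}"])
    show "{0..1::real} \<in> fmeasurable lborel"
      by (intro fmeasurableI) auto
  qed (use T_borel T_sub in auto)
  have T_em: "emeasure lborel (T i) = ennreal (measure lborel (T i))" for i
    using T_fin[of i] by (simp add: emeasure_eq_measure2)
  have covered: "\<exists>i\<in>{i. \<tau> \<in> T i}. \<exists>j. z \<in> V j \<and> V i \<inter> V j \<noteq> {} \<and> (i = j \<or> (i, j) \<in> R)"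
    if z: "z \<in> Z" and \<tau>: "\<tau> \<in> {0..1}" for z \<tau>
  proof -
    have "\<exists>j. z \<in> V j \<and> T j = {0..1} - blocked T j"
    proof (rule ccontr)
      assume "\<not> ?thesis"
      then have full: "measure lborel (T j) = c j" if "z \<in> V j" for j
        using T_full that by blast
      define T' where "T' j = (if z \<in> V j then T j else {})" for j
      have disj: "disjoint_family T'"
      proof (unfold disjoint_family_on_def, intro ballI impI)
        fix i j :: nat assume "i \<noteq> j"
        have *: "T i \<inter> T j = {}" if "(i, j) \<in> R" "z \<in> V i" "z \<in> V j" for i j
          using that T_sub[of j] by (auto simp: blocked_def)
        show "T' i \<inter> T' j = {}"
          using total[OF \<open>i \<noteq> j\<close>] *[of i j] *[of j i] by (auto simp: T'_def)
      qed
      have "(\<Sum>i. ennreal (c i) * indicator (V i) z) = (\<Sum>i. emeasure lborel (T' i))"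
        by (intro suminf_cong) (auto simp: T'_def T_em full)
      also have "\<dots> = emeasure lborel (\<Union>i. T' i)"
        by (intro suminf_emeasure disj) (auto simp: T'_def T_borel)
      also have "\<dots> \<le> emeasure lborel {0..1::real}"
        using T_sub by (intro emeasure_mono) (force simp: T'_def split: if_splits)+
      also have "\<dots> = 1"
        by simp
      finally show False
        using Z[OF z] by simp
    qed
    then obtain j where j: "z \<in> V j" "T j = {0..1} - blocked T j"
      by blast
    show ?thesis
    proof (cases "\<tau> \<in> T j")
      case True
      then show ?thesis
        using j by blast
    next
      case False
      then have "\<tau> \<in> blocked T j"
        using j \<tau> by blast
      then show ?thesis
        using j by (auto simp: blocked_def)
    qed
  qed
  have "\<exists>\<tau>\<in>{0..1::real}. (\<Sum>i. w i * indicator (T i) \<tau>) \<le> b"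
  proof (rule ccontr)
    assume "\<not> ?thesis"
    then have large: "b \<le> (\<Sum>i. w i * indicator (T i) \<tau>)" if "\<tau> \<in> {0..1}" for \<tau>
      using that by (auto simp: not_le intro: less_imp_le)
    have "b = (\<integral>\<^sup>+\<tau>. b * indicator {0..1::real} \<tau> \<partial>lborel)"
      by (simp add: nn_integral_cmult_indicator)
    also have "\<dots> \<le> (\<integral>\<^sup>+\<tau>. (\<Sum>i. w i * indicator (T i) \<tau>) \<partial>lborel)"
      using large by (intro nn_integral_mono) (auto simp: indicator_def)
    also have "\<dots> = (\<Sum>i. \<integral>\<^sup>+\<tau>. w i * indicator (T i) \<tau> \<partial>lborel)"
      using T_borel by (intro nn_integral_suminf) auto
    also have "\<dots> = (\<Sum>i. w i * emeasure lborel (T i))"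
      using T_borel by (intro suminf_cong) (simp add: nn_integral_cmult_indicator)
    also have "\<dots> \<le> (\<Sum>i. ennreal (c i) * w i)"
      by (intro suminf_le) (auto simp: T_em mult.commute T_le intro!: mult_left_mono ennreal_leI)
    also have "\<dots> < b"
      by (rule b)
    finally show False
      by simp
  qed
  then obtain \<tau> where \<tau>: "\<tau> \<in> {0..1}" "(\<Sum>i. w i * indicator (T i) \<tau>) \<le> b"
    by blast
  show ?thesis
  proof (intro exI conjI ballI)
    show "(\<Sum>i. w i * indicator {i. \<tau> \<in> T i} i) \<le> b"
      using \<tau>(2) by (simp add: indicator_def)
  qed (rule covered[OF _ \<tau>(1)])
qed

section \<open>Fibres of maps whose coarea covers are cheap\<close>

lemma diameter_le_dist:
  fixes S :: "'a::metric_space set"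
  assumes "0 \<le> d" "\<And>x y. x \<in> S \<Longrightarrow> y \<in> S \<Longrightarrow> dist x y \<le> d"
  shows "bounded S \<and> diameter S \<le> d"
proof
  show bS: "bounded S"
    using assms(2) by (auto simp: bounded_two_points)
  show "diameter S \<le> d"
  proof (rule ccontr)
    assume "\<not> ?thesis"
    then obtain e where e: "d < e" "e < diameter S"
      using dense not_le by blast
    then show False
      using diameter_lower_bounded[OF bS, of e] assms by fastforce
  qed
qed

text \<open>
  Dropping the factor \<open>2\<^sup>-\<^sup>k\<close> gives a bound by an ordinary power that is also right for \<open>k = 0\<close>, where
  a nonempty set contributes \<open>1\<close>.
\<close>
lemma hausdorff_gauge_nat_le:
  "hausdorff_gauge (real k) U \<le> ennreal (unit_ball_vol (real k) * (diameter U) ^ k)"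
  if "bounded U"
proof -
  have d: "0 \<le> diameter U"
    using that by (rule diameter_ge_0)
  have "(diameter U / 2) powr real k \<le> diameter U ^ k" if "k \<noteq> 0"
  proof (cases "diameter U = 0")
    case False
    then have "(diameter U / 2) powr real k = (diameter U / 2) ^ k"
      using d by (intro powr_realpow) auto
    also have "\<dots> \<le> diameter U ^ k"
      using d by (intro power_mono) auto
    finally show ?thesis .
  qed (use that in auto)
  then show ?thesis
    by (auto simp: hausdorff_gauge_def intro!: ennreal_leI mult_left_mono)
qed

text \<open>
  Weights can be removed from a cover at the price of a constant. The order used for the selection
  compares the dyadic scale of the diameters, so a predecessor of \<open>j\<close> has at least half the
  diameter of \<open>V j\<close>; a set that meets \<open>V j\<close> and has at least half its diameter swallows \<open>V j\<close> when
  enlarged by twice its own diameter.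
\<close>
lemma hausdorff_pre_measure_weighted_cover:
  fixes V :: "nat \<Rightarrow> 'b::metric_space set"
  assumes V: "\<And>i. bounded (V i)" "\<And>i. diameter (V i) \<le> \<delta>" and \<delta>: "0 < \<delta>" and m: "0 < m"
    and c: "\<And>i. 0 \<le> c i"
    and Z: "\<And>z. z \<in> Z \<Longrightarrow> 1 < (\<Sum>i. ennreal (c i) * indicator (V i) z)"
    and b: "(\<Sum>i. ennreal (c i) * ennreal (diameter (V i) ^ m)) < b"
  shows "hausdorff_pre_measure (real m) (5 * \<delta>) Z \<le> ennreal (unit_ball_vol (real m) * 5 ^ m) * b"
proof -
  define d where "d i = diameter (V i)" for i
  have d0: "0 \<le> d i" for i
    unfolding d_def by (rule diameter_ge_0[OF V(1)])
  have dd: "dist x y \<le> d i" if "x \<in> V i" "y \<in> V i" for x y i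
    unfolding d_def by (rule diameter_bounded_bound[OF V(1) that])
  define gen where "gen i = (LEAST n. \<delta> / 2 ^ n \<le> d i)" for i
  \<comment> \<open>Sets of diameter \<open>0\<close> have no dyadic scale and come last.\<close>
  define R where "R = inv_image (less_than <*lex*> less_than <*lex*> less_than)
    (\<lambda>i. (if d i = 0 then 1 else 0 :: nat, gen i, i))"
  have gen_le: "\<delta> / 2 ^ gen i \<le> d i" if "0 < d i" for i
  proof -
    obtain n where "\<delta> / d i < 2 ^ n"
      using real_arch_pow[of 2 "\<delta> / d i"] by auto
    then have "\<delta> / 2 ^ n \<le> d i"
      using that by (simp add: field_simps)
    then show ?thesis
      unfolding gen_def by (rule LeastI)
  qed
  have le_gen: "d i \<le> 2 * (\<delta> / 2 ^ gen i)" for i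
  proof (cases "gen i")
    case 0
    then show ?thesis
      using V(2)[of i] \<delta> by (simp add: d_def)
  next
    case (Suc n)
    then have "\<not> \<delta> / 2 ^ n \<le> d i"
      using not_less_Least[of n "\<lambda>n. \<delta> / 2 ^ n \<le> d i"] by (simp add: gen_def)
    then show ?thesis
      by (simp add: Suc)
  qed
  have R_double: "d j \<le> 2 * d i" if "(i, j) \<in> R" for i j
  proof (cases "d j = 0")
    case True
    then show ?thesis
      using d0 by simp
  next
    case False
    then have "d i \<noteq> 0" "gen i \<le> gen j"
      using that by (auto simp: R_def split: if_splits)
    then have "2 * (\<delta> / 2 ^ gen j) \<le> 2 * (\<delta> / 2 ^ gen i)"
      using \<delta> by (intro mult_left_mono divide_left_mono power_increasing) auto
    also have "\<dots> \<le> 2 * d i"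
      using gen_le[of i] d0[of i] \<open>d i \<noteq> 0\<close> by simp
    finally show ?thesis
      using le_gen[of j] by simp
  qed
  have wfR: "wf R"
    unfolding R_def by (intro wf_inv_image wf_lex_prod wf_less_than)
  have totalR: "(i, j) \<in> R \<or> (j, i) \<in> R" if "i \<noteq> j" for i j
    using that by (auto simp: R_def)
  have "\<exists>J. (\<forall>z\<in>Z. \<exists>i\<in>J. \<exists>j. z \<in> V j \<and> V i \<inter> V j \<noteq> {} \<and> (i = j \<or> (i, j) \<in> R)) \<and>
      (\<Sum>i. ennreal (d i ^ m) * indicator J i) \<le> b"
    by (rule weighted_cover_selection[where c = c])
      (fact wfR, erule totalR, rule c, erule Z, fact b[folded d_def])
  then obtain J where
    J: "\<And>z. z \<in> Z \<Longrightarrow> \<exists>i\<in>J. \<exists>j. z \<in> V j \<and> V i \<inter> V j \<noteq> {} \<and> (i = j \<or> (i, j) \<in> R)"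
    and Jb: "(\<Sum>i. ennreal (d i ^ m) * indicator J i) \<le> b"
    by blast
  define W where "W i = (if i \<in> J then {x. \<exists>y\<in>V i. dist x y \<le> 2 * d i} else {})" for i
  have W: "bounded (W i) \<and> diameter (W i) \<le> 5 * d i" for i
  proof (rule diameter_le_dist)
    fix x y assume "x \<in> W i" "y \<in> W i"
    then obtain x' y' where xy: "x' \<in> V i" "y' \<in> V i" "dist x x' \<le> 2 * d i" "dist y y' \<le> 2 * d i"
      by (auto simp: W_def split: if_splits)
    have "dist x y \<le> dist x x' + dist x' y' + dist y y'"
      using dist_triangle[of x y x'] dist_triangle[of x' y y'] by (simp add: dist_commute)
    then show "dist x y \<le> 5 * d i"
      using xy dd[OF xy(1,2)] by simp
  qed (use d0 in simp)
  have "Z \<subseteq> (\<Union>i. W i)"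
  proof
    fix z assume "z \<in> Z"
    then obtain i j y where ij: "i \<in> J" "z \<in> V j" "y \<in> V i" "y \<in> V j" "i = j \<or> (i, j) \<in> R"
      using J by blast
    have "dist z y \<le> d j"
      using ij by (intro dd)
    also have "\<dots> \<le> 2 * d i"
      using ij(5) R_double[of i j] d0[of i] by auto
    finally show "z \<in> (\<Union>i. W i)"
      using ij by (auto simp: W_def)
  qed
  moreover have "diameter (W i) \<le> 5 * \<delta>" for i
    using W[of i] V(2)[of i] by (simp add: d_def)
  ultimately have "hausdorff_pre_measure (real m) (5 * \<delta>) Z \<le> (\<Sum>i. hausdorff_gauge (real m) (W i))"
    using W by (intro hausdorff_pre_measure_le) auto
  also have "\<dots> \<le> (\<Sum>i. ennreal (unit_ball_vol (real m) * 5 ^ m) * (ennreal (d i ^ m) * indicator J i))"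
  proof (intro suminf_le allI)
    fix i
    show "hausdorff_gauge (real m) (W i) \<le>
        ennreal (unit_ball_vol (real m) * 5 ^ m) * (ennreal (d i ^ m) * indicator J i)"
    proof (cases "i \<in> J")
      case True
      have "hausdorff_gauge (real m) (W i) \<le> ennreal (unit_ball_vol (real m) * diameter (W i) ^ m)"
        using W by (intro hausdorff_gauge_nat_le) auto
      also have "\<dots> \<le> ennreal (unit_ball_vol (real m) * (5 * d i) ^ m)"
        using W[of i] by (intro ennreal_leI mult_left_mono power_mono diameter_ge_0) auto
      also have "\<dots> = ennreal (unit_ball_vol (real m) * 5 ^ m) * ennreal (d i ^ m)"
        using d0[of i] by (simp add: power_mult_distrib ennreal_mult'' mult.assoc[symmetric])
      finally show ?thesis
        using True by simp
    qed (simp add: W_def hausdorff_gauge_def)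
  qed auto
  also have "\<dots> = ennreal (unit_ball_vol (real m) * 5 ^ m) * (\<Sum>i. ennreal (d i ^ m) * indicator J i)"
    by (rule ennreal_suminf_cmult)
  also have "\<dots> \<le> ennreal (unit_ball_vol (real m) * 5 ^ m) * b"
    using Jb by (intro mult_left_mono) auto
  finally show ?thesis .
qed

lemma ennreal_zeroI_small:
  assumes "\<And>e. 0 < e \<Longrightarrow> x \<le> ennreal (D * e)" "0 \<le> D"
  shows "x = 0"
proof -
  have "x \<le> 0"
  proof (rule ennreal_le_epsilon)
    fix e :: real assume "0 < e"
    have "x \<le> ennreal (D * (e / (D + 1)))"
      using \<open>0 < e\<close> assms by (intro assms(1)) simp
    also have "\<dots> \<le> ennreal e"
      using \<open>0 < e\<close> assms(2) by (intro ennreal_leI) (simp add: field_simps)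
    finally show "x \<le> 0 + ennreal e"
      by simp
  qed
  then show ?thesis
    by simp
qed

text \<open>
  The cost of a covering set for the coarea problem: the product of its contribution to a
  \<open>k\<close>-dimensional measure of the fibres that it meets and the contribution of its image to an
  \<open>m\<close>-dimensional measure in the target.
\<close>
definition coarea_gauge ::
    "('a::metric_space \<Rightarrow> 'b::metric_space) \<Rightarrow> nat \<Rightarrow> nat \<Rightarrow> real \<Rightarrow> 'a set \<Rightarrow> ennreal" where
  "coarea_gauge f k m \<delta> U =
     (if U = {} then 0
      else if bounded U \<and> diameter U \<le> \<delta> \<and> bounded (f ` U) \<and> diameter (f ` U) \<le> \<delta>
      then ennreal (diameter U ^ k * diameter (f ` U) ^ m)
      else top)"

lemma coarea_gauge_empty [simp]: "coarea_gauge f k m \<delta> {} = 0"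
  by (simp add: coarea_gauge_def)

lemma coarea_gauge_le:
  assumes "\<And>x y. x \<in> U \<Longrightarrow> y \<in> U \<Longrightarrow> dist x y \<le> s"
    and "\<And>x y. x \<in> U \<Longrightarrow> y \<in> U \<Longrightarrow> dist (f x) (f y) \<le> d"
    and "0 \<le> s" "0 \<le> d" "s \<le> \<delta>" "d \<le> \<delta>"
  shows "coarea_gauge f k m \<delta> U \<le> ennreal (s ^ k * d ^ m)"
proof -
  have s: "bounded U \<and> diameter U \<le> s"
    by (rule diameter_le_dist) (use assms in auto)
  have d: "bounded (f ` U) \<and> diameter (f ` U) \<le> d"
    by (rule diameter_le_dist) (use assms in auto)
  show ?thesis
    using s d assms diameter_ge_0[of U] diameter_ge_0[of "f ` U"]
    by (auto simp: coarea_gauge_def intro!: ennreal_leI mult_mono power_mono)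
qed

text \<open>
  Given a cover \<open>U\<close> of \<open>E\<close> of small cost, the sets \<open>U i\<close> with \<open>z \<in> f ` U i\<close> cover the fibre over
  \<open>z\<close>. If the premeasure of this fibre exceeds \<open>t\<close>, then the weights \<open>c i\<close>, the \<open>k\<close>-dimensional
  contributions of the \<open>U i\<close> divided by \<open>t\<close>, sum to more than \<open>1\<close> over these \<open>i\<close>. So the
  images \<open>f ` U i\<close> with weights \<open>c i\<close> are a weighted cover of the set of all such \<open>z\<close>, and its
  weighted cost is a multiple of the cost of \<open>U\<close>.
\<close>
lemma coarea_null_imp_fiber_level_null:
  fixes f :: "'a::metric_space \<Rightarrow> 'b::metric_space"
  assumes m: "0 < m" and null: "\<And>\<delta>. 0 < \<delta> \<Longrightarrow> cover_measure (coarea_gauge f k m \<delta>) E = 0"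
    and t: "0 < t" and \<delta>0: "0 < \<delta>0"
  shows "hausdorff_measure (real m) {z. ennreal t < hausdorff_pre_measure (real k) \<delta>0 (f -` {z} \<inter> E)} = 0"
    (is "hausdorff_measure _ ?Z = 0")
  unfolding hausdorff_measure_null_iff
proof (intro allI impI)
  fix \<delta>1 :: real assume \<delta>1: "0 < \<delta>1"
  define \<delta> where "\<delta> = min \<delta>0 (\<delta>1 / 5)"
  have \<delta>: "0 < \<delta>" "\<delta> \<le> \<delta>0" "5 * \<delta> \<le> \<delta>1"
    using \<delta>0 \<delta>1 by (auto simp: \<delta>_def)
  define D where "D = unit_ball_vol (real m) * 5 ^ m * (unit_ball_vol (real k) / t * 2)"
  show "hausdorff_pre_measure (real m) \<delta>1 ?Z = 0"
  proof (rule ennreal_zeroI_small)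
    show "0 \<le> D"
      using t by (simp add: D_def)
    fix e :: real assume e: "0 < e"
    have "cover_measure (coarea_gauge f k m \<delta>) E < ennreal e"
      using null[OF \<delta>(1)] e by simp
    then obtain U :: "nat \<Rightarrow> 'a set"
      where U: "E \<subseteq> (\<Union>i. U i)" "(\<Sum>i. coarea_gauge f k m \<delta> (U i)) < ennreal e"
      by (rule cover_measure_less_obtain)
    have "coarea_gauge f k m \<delta> (U i) \<noteq> top" for i
    proof -
      have "coarea_gauge f k m \<delta> (U i) \<le> (\<Sum>i. coarea_gauge f k m \<delta> (U i))"
        using sum_le_suminf[of "\<lambda>i. coarea_gauge f k m \<delta> (U i)" "{i}"] by simp
      then show ?thesis
        using U(2) by (auto simp: top_unique)
    qed
    then have adm: "bounded (U i) \<and> diameter (U i) \<le> \<delta> \<and> bounded (f ` U i) \<and> diameter (f ` U i) \<le> \<delta>" for i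
      unfolding coarea_gauge_def using \<delta>(1) by (cases "U i = {}") (fastforce split: if_splits)+
    have gauge: "coarea_gauge f k m \<delta> (U i) = ennreal (diameter (U i) ^ k * diameter (f ` U i) ^ m)" for i
      using adm[of i] m by (auto simp: coarea_gauge_def)
    define c where "c i = unit_ball_vol (real k) / t * diameter (U i) ^ k" for i
    have c0: "0 \<le> c i" for i
      using adm[of i] t diameter_ge_0[of "U i"] by (simp add: c_def)
    have "hausdorff_pre_measure (real m) (5 * \<delta>) ?Z
        \<le> ennreal (unit_ball_vol (real m) * 5 ^ m) * ennreal (unit_ball_vol (real k) / t * 2 * e)"
    proof (rule hausdorff_pre_measure_weighted_cover[where V = "\<lambda>i. f ` U i" and c = c])
      fix z assume z: "z \<in> ?Z"
      define W where "W i = (if z \<in> f ` U i then U i else {})" for i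
      have "ennreal t < hausdorff_pre_measure (real k) \<delta>0 (f -` {z} \<inter> E)"
        using z by simp
      also have "\<dots> \<le> (\<Sum>i. hausdorff_gauge (real k) (W i))"
      proof (rule hausdorff_pre_measure_le)
        show "f -` {z} \<inter> E \<subseteq> (\<Union>i. W i)"
          using U(1) by (fastforce simp: W_def)
        show "bounded (W i)" "diameter (W i) \<le> \<delta>0" for i
          using adm[of i] \<delta> \<delta>0 by (auto simp: W_def)
      qed
      also have "\<dots> \<le> (\<Sum>i. ennreal t * (ennreal (c i) * indicator (f ` U i) z))"
      proof (intro suminf_le allI)
        fix i
        have "ennreal t * ennreal (c i) = ennreal (unit_ball_vol (real k) * diameter (U i) ^ k)"
          using t by (simp add: ennreal_mult'[symmetric] c_def)
        then show "hausdorff_gauge (real k) (W i) \<le> ennreal t * (ennreal (c i) * indicator (f ` U i) z)"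
          using hausdorff_gauge_nat_le[of "U i" k] adm[of i]
          by (cases "z \<in> f ` U i") (simp_all add: W_def, simp add: hausdorff_gauge_def)
      qed auto
      also have "\<dots> = ennreal t * (\<Sum>i. ennreal (c i) * indicator (f ` U i) z)"
        by (rule ennreal_suminf_cmult)
      finally have *: "ennreal t < ennreal t * (\<Sum>i. ennreal (c i) * indicator (f ` U i) z)" .
      show "1 < (\<Sum>i. ennreal (c i) * indicator (f ` U i) z)"
      proof (rule ccontr)
        assume "\<not> ?thesis"
        then have "ennreal t * (\<Sum>i. ennreal (c i) * indicator (f ` U i) z) \<le> ennreal t * 1"
          by (intro mult_left_mono) (auto simp: not_less)
        then show False
          using * by simp
      qed
    next
      have "(\<Sum>i. ennreal (c i) * ennreal (diameter (f ` U i) ^ m))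
          = (\<Sum>i. ennreal (unit_ball_vol (real k) / t) * coarea_gauge f k m \<delta> (U i))"
      proof (intro suminf_cong)
        fix i
        have "0 \<le> diameter (f ` U i) ^ m" "0 \<le> unit_ball_vol (real k) / t"
          using adm[of i] t diameter_ge_0[of "f ` U i"] by auto
        then show "ennreal (c i) * ennreal (diameter (f ` U i) ^ m)
            = ennreal (unit_ball_vol (real k) / t) * coarea_gauge f k m \<delta> (U i)"
          by (simp only: gauge ennreal_mult'[symmetric] ennreal_mult''[symmetric] c_def mult.assoc)
      qed
      also have "\<dots> = ennreal (unit_ball_vol (real k) / t) * (\<Sum>i. coarea_gauge f k m \<delta> (U i))"
        by (rule ennreal_suminf_cmult)
      also have "\<dots> \<le> ennreal (unit_ball_vol (real k) / t) * ennreal e"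
        using U(2) by (intro mult_left_mono) auto
      also have "\<dots> = ennreal (unit_ball_vol (real k) / t * e)"
        using t by (intro ennreal_mult'[symmetric]) simp
      also have "\<dots> < ennreal (unit_ball_vol (real k) / t * 2 * e)"
        using t e by (intro ennreal_lessI) (simp_all add: divide_strict_right_mono)
      finally show "(\<Sum>i. ennreal (c i) * ennreal (diameter (f ` U i) ^ m))
          < ennreal (unit_ball_vol (real k) / t * 2 * e)" .
    qed (use adm c0 \<delta> m in auto)
    also have "\<dots> = ennreal (D * e)"
      using t e by (simp add: D_def ennreal_mult'[symmetric] mult.assoc)
    finally show "hausdorff_pre_measure (real m) \<delta>1 ?Z \<le> ennreal (D * e)"
      using hausdorff_pre_measure_antimono[OF \<delta>(3)] order_trans by blast
  qed
qed

lemma coarea_null_imp_fibers_null: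
  fixes f :: "'a::metric_space \<Rightarrow> 'b::metric_space"
  assumes m: "0 < m" and null: "\<And>\<delta>. 0 < \<delta> \<Longrightarrow> cover_measure (coarea_gauge f k m \<delta>) E = 0"
  shows "hausdorff_measure (real m) {z. hausdorff_measure (real k) (f -` {z} \<inter> E) \<noteq> 0} = 0"
proof (rule hausdorff_measure_null_subset)
  let ?Z = "\<lambda>p q. {z. ennreal (inverse (real (Suc p)))
      < hausdorff_pre_measure (real k) (inverse (real (Suc q))) (f -` {z} \<inter> E)}"
  show "hausdorff_measure (real m) (\<Union>p. \<Union>q. ?Z p q) = 0"
    by (intro hausdorff_measure_UN_null coarea_null_imp_fiber_level_null m null) auto
  show "{z. hausdorff_measure (real k) (f -` {z} \<inter> E) \<noteq> 0} \<subseteq> (\<Union>p. \<Union>q. ?Z p q)"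
  proof
    fix z assume "z \<in> {z. hausdorff_measure (real k) (f -` {z} \<inter> E) \<noteq> 0}"
    then obtain \<delta> where \<delta>: "0 < \<delta>" "hausdorff_pre_measure (real k) \<delta> (f -` {z} \<inter> E) \<noteq> 0"
      unfolding mem_Collect_eq hausdorff_measure_null_iff by blast
    obtain q where "inverse (real (Suc q)) < \<delta>"
      using reals_Archimedean[OF \<delta>(1)] by blast
    then have "hausdorff_pre_measure (real k) \<delta> (f -` {z} \<inter> E)
        \<le> hausdorff_pre_measure (real k) (inverse (real (Suc q))) (f -` {z} \<inter> E)"
      by (intro hausdorff_pre_measure_antimono) simp
    then have "0 < hausdorff_pre_measure (real k) (inverse (real (Suc q))) (f -` {z} \<inter> E)"
      using \<delta>(2) by (metis le_zero_eq zero_less_iff_neq_zero)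
    then obtain y where y: "0 < y" "y < hausdorff_pre_measure (real k) (inverse (real (Suc q))) (f -` {z} \<inter> E)"
      using dense by blast
    then have "y < top"
      using top.not_eq_extremum by fastforce
    with y(1) have "0 < enn2real y"
      by (simp add: enn2real_positive_iff)
    then obtain p where "inverse (real (Suc p)) < enn2real y"
      using reals_Archimedean by blast
    then have "ennreal (inverse (real (Suc p))) \<le> y"
      using ennreal_leI[of "inverse (real (Suc p))" "enn2real y"] \<open>y < top\<close>
      by (simp add: ennreal_enn2real_if split: if_splits)
    then show "z \<in> (\<Union>p. \<Union>q. ?Z p q)"
      using y(2) by (auto intro: order_le_less_trans)
  qed
qed

section \<open>Coarea covers in Euclidean space\<close>

lemma emeasure_lebesgue_cball:
  fixes x :: "'a::euclidean_space"
  assumes "0 \<le> r"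
  shows "emeasure lebesgue (cball x r) = ennreal (unit_ball_vol (real DIM('a)) * r ^ DIM('a))"
  using emeasure_cball[OF assms, of x] by simp

lemma emeasure_lebesgue_ball:
  fixes x :: "'a::euclidean_space"
  assumes "0 \<le> r"
  shows "emeasure lebesgue (ball x r) = ennreal (unit_ball_vol (real DIM('a)) * r ^ DIM('a))"
  using emeasure_ball[OF assms, of x] by simp

text \<open>
  The \<open>5r\<close>-covering lemma with balls inside \<open>G\<close> whose radii are as small as desired, listed by
  natural numbers.
\<close>
lemma Vitali_disjoint_balls:
  fixes G :: "'a::euclidean_space set"
  assumes "open G" "E \<subseteq> G" "\<And>x. x \<in> E \<Longrightarrow> 0 < \<rho> x"
  obtains I :: "nat set" and x r where
    "\<And>i. i \<in> I \<Longrightarrow> x i \<in> E \<and> 0 < r i \<and> r i < \<rho> (x i) \<and> cball (x i) (r i) \<subseteq> G"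
    "disjoint_family_on (\<lambda>i. cball (x i) (r i)) I"
    "E \<subseteq> (\<Union>i\<in>I. cball (x i) (5 * r i))"
proof -
  have "\<exists>r. 0 < r \<and> r \<le> 1 \<and> r < \<rho> x \<and> cball x r \<subseteq> G" if "x \<in> E" for x
  proof -
    obtain e where e: "0 < e" "cball x e \<subseteq> G"
      using assms(1,2) \<open>x \<in> E\<close> open_contains_cball by blast
    then show ?thesis
      using assms(3)[OF that]
      by (intro exI[of _ "min e (min 1 (\<rho> x / 2))"]) (auto simp: subset_eq)
  qed
  then obtain R where R: "\<And>x. x \<in> E \<Longrightarrow> 0 < R x \<and> R x \<le> 1 \<and> R x < \<rho> x \<and> cball x (R x) \<subseteq> G"
    by metis
  have "E \<subseteq> (\<Union>x\<in>E. cball x (R x))"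
    using R by force
  then obtain C where C: "countable C" "C \<subseteq> E"
    "pairwise (\<lambda>x y. disjnt (cball x (R x)) (cball y (R y))) C"
    "E \<subseteq> (\<Union>x\<in>C. cball x (5 * R x))"
    by (rule Vitali_covering_lemma_cballs[where a = "\<lambda>x. x" and r = R and B = 1]) (use R in auto)
  define I where "I = to_nat_on C ` C"
  define x where "x = from_nat_into C"
  have x_to: "x (to_nat_on C y) = y" if "y \<in> C" for y
    unfolding x_def using C(1) that by simp
  have xC: "x i \<in> C" if "i \<in> I" for i
    using that x_to by (auto simp: I_def)
  have inj: "x i \<noteq> x j" if "i \<in> I" "j \<in> I" "i \<noteq> j" for i j
    using that x_to by (auto simp: I_def)
  show thesis
  proof (rule that[of I x "\<lambda>i. R (x i)"])
    show "x i \<in> E \<and> 0 < R (x i) \<and> R (x i) < \<rho> (x i) \<and> cball (x i) (R (x i)) \<subseteq> G" if "i \<in> I" for i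
      using R xC[OF that] C(2) by blast
    show "disjoint_family_on (\<lambda>i. cball (x i) (R (x i))) I"
      unfolding disjoint_family_on_def
      using C(3) xC inj by (auto simp: pairwise_def disjnt_def)
    show "E \<subseteq> (\<Union>i\<in>I. cball (x i) (5 * R (x i)))"
    proof
      fix y assume "y \<in> E"
      then obtain z where "z \<in> C" "y \<in> cball z (5 * R z)"
        using C(4) by blast
      then show "y \<in> (\<Union>i\<in>I. cball (x i) (5 * R (x i)))"
        using x_to by (intro UN_I[of "to_nat_on C z"]) (auto simp: I_def)
    qed
  qed
qed

text \<open>
  A form of Eilenberg's inequality. The image of a ball of radius \<open>5r\<close> has diameter at most \<open>10 L r\<close>,
  so the ball has cost at most a constant times \<open>r\<^sup>k\<^sup>+\<^sup>m\<close>, that is, times the volume of the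
  concentric ball of radius \<open>r\<close>; and the latter balls can be taken disjoint in \<open>G\<close>.
\<close>
lemma coarea_cover_le_volume:
  fixes f :: "'a::euclidean_space \<Rightarrow> 'b::metric_space"
  assumes f: "L-lipschitz_on A f" and dim: "DIM('a) = k + m" and \<delta>: "0 < \<delta>"
    and E: "E \<subseteq> A" "E \<subseteq> G" and G: "open G"
  shows "cover_measure (coarea_gauge f k m \<delta>) E
    \<le> ennreal (10 ^ k * (10 * L) ^ m / unit_ball_vol (real DIM('a))) * emeasure lebesgue G"
proof -
  have L: "0 \<le> L"
    using f by (rule lipschitz_on_nonneg)
  define \<omega> where "\<omega> = unit_ball_vol (real DIM('a))"
  have \<omega>: "0 < \<omega>"
    by (simp add: \<omega>_def)
  define C where "C = 10 ^ k * (10 * L) ^ m / \<omega>"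
  have C: "0 \<le> C"
    using L \<omega> by (simp add: C_def)
  define \<rho> where "\<rho> = \<delta> / (10 * (L + 1))"
  have \<rho>: "0 < \<rho>"
    using \<delta> L by (simp add: \<rho>_def)
  obtain I :: "nat set" and x r where
    I: "\<And>i. i \<in> I \<Longrightarrow> x i \<in> E \<and> 0 < r i \<and> r i < \<rho> \<and> cball (x i) (r i) \<subseteq> G"
    and disj: "disjoint_family_on (\<lambda>i. cball (x i) (r i)) I"
    and cov: "E \<subseteq> (\<Union>i\<in>I. cball (x i) (5 * r i))"
    by (rule Vitali_disjoint_balls[OF G E(2), where \<rho> = "\<lambda>_. \<rho>"]) (use \<rho> in auto)
  have piece: "coarea_gauge f k m \<delta> (E \<inter> cball (x i) (5 * r i))
      \<le> ennreal C * emeasure lebesgue (cball (x i) (r i))" if i: "i \<in> I" for i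
  proof -
    have r: "0 < r i" "10 * r i * (L + 1) \<le> \<delta>"
      using I[OF i] L by (auto simp: \<rho>_def field_simps)
    have "10 * r i * 1 \<le> 10 * r i * (L + 1)" "10 * r i * L \<le> 10 * r i * (L + 1)"
      using r(1) L by (intro mult_left_mono; simp)+
    then have le: "10 * r i \<le> \<delta>" "L * (10 * r i) \<le> \<delta>"
      using r(2) by (simp_all add: algebra_simps)
    have "coarea_gauge f k m \<delta> (E \<inter> cball (x i) (5 * r i)) \<le> ennreal ((10 * r i) ^ k * (L * (10 * r i)) ^ m)"
    proof (rule coarea_gauge_le)
      fix y z assume yz: "y \<in> E \<inter> cball (x i) (5 * r i)" "z \<in> E \<inter> cball (x i) (5 * r i)"
      then show *: "dist y z \<le> 10 * r i"
        using dist_triangle3[of y z "x i"] by auto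
      have "dist (f y) (f z) \<le> L * dist y z"
        using f yz E(1) by (intro lipschitz_onD) auto
      also have "\<dots> \<le> L * (10 * r i)"
        using * L by (intro mult_left_mono)
      finally show "dist (f y) (f z) \<le> L * (10 * r i)" .
    qed (use r L le in auto)
    also have "(10 * r i) ^ k * (L * (10 * r i)) ^ m = C * (\<omega> * r i ^ DIM('a))"
      using \<omega> by (simp add: C_def dim power_add power_mult_distrib)
    also have "ennreal \<dots> = ennreal C * emeasure lebesgue (cball (x i) (r i))"
      using emeasure_lebesgue_cball[of "r i" "x i"] r(1) by (simp only: ennreal_mult'[OF C] \<omega>_def less_imp_le)
    finally show ?thesis .
  qed
  have "cover_measure (coarea_gauge f k m \<delta>) E
      \<le> cover_measure (coarea_gauge f k m \<delta>) (\<Union>i\<in>I. E \<inter> cball (x i) (5 * r i))"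
    using cov by (intro cover_measure_mono) auto
  also have "\<dots> \<le> (\<Sum>i. cover_measure (coarea_gauge f k m \<delta>) (E \<inter> cball (x i) (5 * r i)) * indicator I i)"
    by (intro cover_measure_UN_index) simp
  also have "\<dots> \<le> (\<Sum>i. ennreal C * emeasure lebesgue (if i \<in> I then cball (x i) (r i) else {}))"
  proof (intro suminf_le allI)
    fix i
    show "cover_measure (coarea_gauge f k m \<delta>) (E \<inter> cball (x i) (5 * r i)) * indicator I i
        \<le> ennreal C * emeasure lebesgue (if i \<in> I then cball (x i) (r i) else {})"
      using piece[of i]
        cover_measure_le_gauge[of "coarea_gauge f k m \<delta>" "E \<inter> cball (x i) (5 * r i)"]
      by (cases "i \<in> I") (auto intro: order_trans)
  qed auto
  also have "\<dots> = ennreal C * (\<Sum>i. emeasure lebesgue (if i \<in> I then cball (x i) (r i) else {}))"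
    by (rule ennreal_suminf_cmult)
  also have "(\<Sum>i. emeasure lebesgue (if i \<in> I then cball (x i) (r i) else {}))
      = emeasure lebesgue (\<Union>i. if i \<in> I then cball (x i) (r i) else {})"
    using disj by (intro suminf_emeasure) (auto simp: disjoint_family_on_def)
  also have "\<dots> \<le> emeasure lebesgue G"
    using I G by (intro emeasure_mono) (auto split: if_splits)
  finally show ?thesis
    by (simp add: C_def \<omega>_def mult_left_mono)
qed

text \<open>
  One improvement of the constant \<open>\<Gamma>\<close>. Choose disjoint balls in \<open>G\<close> whose \<open>5\<close>-fold enlargements
  cover \<open>E'\<close>. If finitely many of them fill a fixed fraction of \<open>G\<close>, then so do the slabs inside
  them; on the slabs the constant is \<open>\<epsilon>\<close>, and on the open set that remains it is still \<open>\<Gamma>\<close>.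
  Otherwise the slightly larger balls form an open set around \<open>E'\<close> of at most half the measure of
  \<open>G\<close>, and applying the bound there gains a factor \<open>2\<close>.
\<close>
lemma cover_measure_le_volume_step:
  fixes g :: "'a::euclidean_space set \<Rightarrow> ennreal"
  assumes g0: "g {} = 0" and \<eta>: "0 < \<eta>" and \<epsilon>: "0 \<le> \<epsilon>" "\<epsilon> \<le> \<Gamma>"
    and slab: "\<And>x. x \<in> E \<Longrightarrow> \<exists>\<rho>>0. \<forall>r. 0 < r \<and> r < \<rho> \<longrightarrow>
        (\<exists>S. closed S \<and> S \<subseteq> cball x r \<and> \<eta> * r ^ DIM('a) \<le> measure lebesgue S \<and>
             cover_measure g (S \<inter> E) \<le> ennreal (\<epsilon> * measure lebesgue S))"
    and bound: "\<And>E' G. E' \<subseteq> E \<Longrightarrow> open G \<Longrightarrow> E' \<subseteq> G \<Longrightarrow> G \<in> lmeasurable \<Longrightarrow>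
        cover_measure g E' \<le> ennreal (\<Gamma> * measure lebesgue G)"
    and \<theta>: "\<theta> \<le> 1 / 2" "\<theta> \<le> \<eta> / (unit_ball_vol (real DIM('a)) * (2 * 6 ^ DIM('a)))"
    and E': "E' \<subseteq> E" "E' \<subseteq> G" and G: "open G" "G \<in> lmeasurable"
  shows "cover_measure g E' \<le> ennreal ((\<Gamma> - \<theta> * (\<Gamma> - \<epsilon>)) * measure lebesgue G)"
proof -
  define n where "n = DIM('a)"
  define \<omega> where "\<omega> = unit_ball_vol (real n)"
  have \<omega>: "0 < \<omega>"
    by (simp add: \<omega>_def)
  define M where "M = measure lebesgue G"
  have M: "0 \<le> M"
    by (simp add: M_def)
  obtain \<rho> where \<rho>: "\<And>x. x \<in> E \<Longrightarrow> 0 < \<rho> x"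
    "\<And>x r. x \<in> E \<Longrightarrow> 0 < r \<Longrightarrow> r < \<rho> x \<Longrightarrow>
        \<exists>S. closed S \<and> S \<subseteq> cball x r \<and> \<eta> * r ^ n \<le> measure lebesgue S \<and>
             cover_measure g (S \<inter> E) \<le> ennreal (\<epsilon> * measure lebesgue S)"
    using slab unfolding n_def by metis
  obtain I :: "nat set" and x r where
    I: "\<And>i. i \<in> I \<Longrightarrow> x i \<in> E' \<and> 0 < r i \<and> r i < \<rho> (x i) \<and> cball (x i) (r i) \<subseteq> G"
    and disj: "disjoint_family_on (\<lambda>i. cball (x i) (r i)) I"
    and cov: "E' \<subseteq> (\<Union>i\<in>I. cball (x i) (5 * r i))"
    by (rule Vitali_disjoint_balls[OF G(1) E'(2), where \<rho> = \<rho>]) (use \<rho> E' in auto)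
  have "\<exists>S. closed S \<and> S \<subseteq> cball (x i) (r i) \<and> \<eta> * r i ^ n \<le> measure lebesgue S \<and>
             cover_measure g (S \<inter> E) \<le> ennreal (\<epsilon> * measure lebesgue S)" if "i \<in> I" for i
    using I[OF that] E'(1) by (intro \<rho>(2)) auto
  then obtain S where S: "\<And>i. i \<in> I \<Longrightarrow> closed (S i)" "\<And>i. i \<in> I \<Longrightarrow> S i \<subseteq> cball (x i) (r i)"
    "\<And>i. i \<in> I \<Longrightarrow> \<eta> * r i ^ n \<le> measure lebesgue (S i)"
    "\<And>i. i \<in> I \<Longrightarrow> cover_measure g (S i \<inter> E) \<le> ennreal (\<epsilon> * measure lebesgue (S i))"
    by metis
  have S_meas: "S i \<in> lmeasurable" if "i \<in> I" for i
    using S(1,2)[OF that] bounded_subset[OF bounded_cball]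
    by (intro lmeasurable_compact) (auto simp: compact_eq_bounded_closed)
  show ?thesis
  proof (cases "\<exists>F\<subseteq>I. finite F \<and> M / (2 * 6 ^ n) \<le> (\<Sum>i\<in>F. \<omega> * r i ^ n)")
    case True
    then obtain F where F: "F \<subseteq> I" "finite F" "M / (2 * 6 ^ n) \<le> (\<Sum>i\<in>F. \<omega> * r i ^ n)"
      by blast
    define s where "s = (\<Sum>i\<in>F. measure lebesgue (S i))"
    define V where "V = (\<Union>i\<in>F. S i)"
    have V: "closed V" "V \<in> lmeasurable" "V \<subseteq> G"
      unfolding V_def
      using F S(1) S_meas I S(2) by (blast intro: closed_UN fmeasurable.finite_UN)+
    have "measure lebesgue V = s"
      unfolding V_def s_def
    proof (rule measure_UNION')
      show "pairwise (\<lambda>i j. disjnt (S i) (S j)) F"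
        using disj S(2) F(1) unfolding pairwise_def disjnt_def disjoint_family_on_def by blast
    qed (use F S_meas in auto)
    then have mG: "measure lebesgue (G - V) = M - s"
      using measurable_measure_Diff[OF G(2) _ V(3)] V(2) by (simp add: M_def fmeasurableD)
    have "\<theta> * M \<le> (\<eta> / \<omega>) * (M / (2 * 6 ^ n))"
      using mult_right_mono[OF \<theta>(2) M] by (simp add: \<omega>_def n_def)
    also have "\<dots> \<le> (\<eta> / \<omega>) * (\<Sum>i\<in>F. \<omega> * r i ^ n)"
      using F(3) \<eta> \<omega> by (intro mult_left_mono) auto
    also have "\<dots> = (\<Sum>i\<in>F. \<eta> * r i ^ n)"
      using \<omega> by (simp add: sum_distrib_left)
    also have "\<dots> \<le> s"
      unfolding s_def using F S(3) by (intro sum_mono) auto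
    finally have s: "\<theta> * M \<le> s" .
    have sM: "s \<le> M"
      using mG measure_nonneg[of lebesgue "G - V"] by simp
    have "cover_measure g E' \<le> cover_measure g ((\<Union>i\<in>F. S i \<inter> E) \<union> (E' - V))"
      using E'(1) by (intro cover_measure_mono) (auto simp: V_def)
    also have "\<dots> \<le> cover_measure g (\<Union>i\<in>F. S i \<inter> E) + cover_measure g (E' - V)"
      by (rule cover_measure_Un) (rule g0)
    also have "\<dots> \<le> (\<Sum>i\<in>F. cover_measure g (S i \<inter> E)) + ennreal (\<Gamma> * measure lebesgue (G - V))"
    proof (rule add_mono)
      show "cover_measure g (\<Union>i\<in>F. S i \<inter> E) \<le> (\<Sum>i\<in>F. cover_measure g (S i \<inter> E))"
        by (rule cover_measure_UN_finite) (rule g0, rule F)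
      show "cover_measure g (E' - V) \<le> ennreal (\<Gamma> * measure lebesgue (G - V))"
        using E' G V by (intro bound) (auto intro: open_Diff fmeasurable_Diff simp: fmeasurableD)
    qed
    also have "\<dots> \<le> (\<Sum>i\<in>F. ennreal (\<epsilon> * measure lebesgue (S i))) + ennreal (\<Gamma> * measure lebesgue (G - V))"
      using F S(4) by (intro add_mono sum_mono) auto
    also have "\<dots> = ennreal (\<epsilon> * s) + ennreal (\<Gamma> * (M - s))"
      using \<epsilon>(1) by (simp add: s_def sum_distrib_left mG sum_ennreal)
    also have "\<dots> = ennreal (\<epsilon> * s + \<Gamma> * (M - s))"
      using \<epsilon> sM by (intro ennreal_plus[symmetric]) (auto simp: s_def sum_nonneg)
    also have "\<dots> \<le> ennreal ((\<Gamma> - \<theta> * (\<Gamma> - \<epsilon>)) * M)"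
    proof (rule ennreal_leI)
      have "(\<Gamma> - \<epsilon>) * (\<theta> * M) \<le> (\<Gamma> - \<epsilon>) * s"
        using s \<epsilon> by (intro mult_left_mono) auto
      then show "\<epsilon> * s + \<Gamma> * (M - s) \<le> (\<Gamma> - \<theta> * (\<Gamma> - \<epsilon>)) * M"
        by (simp add: algebra_simps)
    qed
    finally show ?thesis
      by (simp add: M_def)
  next
    case False
    \<comment> \<open>Open balls of radius \<open>6r\<close> contain the closed balls of radius \<open>5r\<close>.\<close>
    define G2 where "G2 = (\<Union>i\<in>I. ball (x i) (6 * r i))"
    have E'G2: "E' \<subseteq> G2"
    proof
      fix y assume "y \<in> E'"
      then obtain i where i: "i \<in> I" "y \<in> cball (x i) (5 * r i)"
        using cov by blast
      then have "y \<in> ball (x i) (6 * r i)"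
        using I[OF i(1)] by auto
      then show "y \<in> G2"
        using i by (auto simp: G2_def)
    qed
    have "emeasure lebesgue G2 = emeasure lebesgue (\<Union>i. if i \<in> I then ball (x i) (6 * r i) else {})"
      unfolding G2_def by (rule arg_cong[where f = "emeasure lebesgue"]) (auto split: if_splits)
    also have "\<dots> \<le> (\<Sum>i. emeasure lebesgue (if i \<in> I then ball (x i) (6 * r i) else {}))"
      by (intro emeasure_subadditive_countably) auto
    also have "\<dots> = (SUP N. \<Sum>i<N. emeasure lebesgue (if i \<in> I then ball (x i) (6 * r i) else {}))"
      by (rule suminf_eq_SUP)
    also have "\<dots> \<le> ennreal (M / 2)"
    proof (rule SUP_least)
      fix N :: nat
      define F where "F = {..<N} \<inter> I"
      have "(\<Sum>i<N. emeasure lebesgue (if i \<in> I then ball (x i) (6 * r i) else {}))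
          = (\<Sum>i\<in>F. emeasure lebesgue (ball (x i) (6 * r i)))"
        unfolding F_def by (intro sum.mono_neutral_cong_right) auto
      also have "\<dots> = (\<Sum>i\<in>F. ennreal (6 ^ n * (\<omega> * r i ^ n)))"
      proof (intro sum.cong refl)
        fix i assume "i \<in> F"
        then have "0 \<le> r i"
          using I by (auto simp: F_def less_imp_le)
        then have "emeasure lebesgue (ball (x i) (6 * r i)) = ennreal (\<omega> * (6 * r i) ^ n)"
          unfolding \<omega>_def n_def by (intro emeasure_lebesgue_ball) simp
        then show "emeasure lebesgue (ball (x i) (6 * r i)) = ennreal (6 ^ n * (\<omega> * r i ^ n))"
          by (simp only: power_mult_distrib mult_ac)
      qed
      also have "\<dots> = ennreal (6 ^ n * (\<Sum>i\<in>F. \<omega> * r i ^ n))"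
        using I \<omega> by (subst sum_ennreal) (auto simp: F_def sum_distrib_left less_imp_le)
      also have "\<dots> \<le> ennreal (M / 2)"
      proof (rule ennreal_leI)
        have "\<not> M / (2 * 6 ^ n) \<le> (\<Sum>i\<in>F. \<omega> * r i ^ n)"
          using False by (auto simp: F_def)
        then show "6 ^ n * (\<Sum>i\<in>F. \<omega> * r i ^ n) \<le> M / 2"
          by (simp add: field_simps)
      qed
      finally show "(\<Sum>i<N. emeasure lebesgue (if i \<in> I then ball (x i) (6 * r i) else {})) \<le> ennreal (M / 2)" .
    qed
    finally have em: "emeasure lebesgue G2 \<le> ennreal (M / 2)" .
    have oG2: "open G2"
      by (auto simp: G2_def)
    then have mG2: "G2 \<in> lmeasurable"
      using em by (intro fmeasurableI) (auto intro: order_le_less_trans)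
    have "measure lebesgue G2 \<le> M / 2"
      using em mG2 M by (simp add: emeasure_eq_measure2)
    have "cover_measure g E' \<le> ennreal (\<Gamma> * measure lebesgue G2)"
      by (rule bound[OF E'(1) oG2 E'G2 mG2])
    also have "\<dots> \<le> ennreal ((\<Gamma> - \<theta> * (\<Gamma> - \<epsilon>)) * M)"
    proof (rule ennreal_leI)
      have "\<theta> * (\<Gamma> - \<epsilon>) \<le> 1 / 2 * (\<Gamma> - \<epsilon>)"
        using \<theta> \<epsilon> by (intro mult_right_mono) auto
      then have "\<Gamma> / 2 * M \<le> (\<Gamma> - \<theta> * (\<Gamma> - \<epsilon>)) * M"
        using M \<epsilon> by (intro mult_right_mono) auto
      moreover have "\<Gamma> * measure lebesgue G2 \<le> \<Gamma> * (M / 2)"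
        using \<open>measure lebesgue G2 \<le> M / 2\<close> \<epsilon> by (intro mult_left_mono) auto
      ultimately show "\<Gamma> * measure lebesgue G2 \<le> (\<Gamma> - \<theta> * (\<Gamma> - \<epsilon>)) * M"
        by simp
    qed
    finally show ?thesis
      by (simp add: M_def)
  qed
qed

text \<open>
  A differentiation theorem for outer measures of Method I type: a local bound by
  \<open>\<epsilon>\<close> times volume on slabs of nonvanishing relative size, together with some bound
  by volume, gives the bound by \<open>\<epsilon>\<close> times volume on \<open>E\<close>. Each application of the previous lemma shrinks
  the excess of the constant over \<open>\<epsilon>\<close> by the factor \<open>1 - \<theta>\<close>.
\<close>
lemma cover_measure_le_volume:
  fixes g :: "'a::euclidean_space set \<Rightarrow> ennreal"
  assumes g0: "g {} = 0" and \<eta>: "0 < \<eta>" and \<epsilon>: "0 \<le> \<epsilon>"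
    and slab: "\<And>x. x \<in> E \<Longrightarrow> \<exists>\<rho>>0. \<forall>r. 0 < r \<and> r < \<rho> \<longrightarrow>
        (\<exists>S. closed S \<and> S \<subseteq> cball x r \<and> \<eta> * r ^ DIM('a) \<le> measure lebesgue S \<and>
             cover_measure g (S \<inter> E) \<le> ennreal (\<epsilon> * measure lebesgue S))"
    and crude: "\<And>E' G. E' \<subseteq> E \<Longrightarrow> open G \<Longrightarrow> E' \<subseteq> G \<Longrightarrow> G \<in> lmeasurable \<Longrightarrow>
        cover_measure g E' \<le> ennreal (C * measure lebesgue G)"
    and G: "E \<subseteq> G" "open G" "G \<in> lmeasurable"
  shows "cover_measure g E \<le> ennreal (\<epsilon> * measure lebesgue G)"
proof -
  define \<theta> where "\<theta> = min (1 / 2) (\<eta> / (unit_ball_vol (real DIM('a)) * (2 * 6 ^ DIM('a))))"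
  have \<theta>: "0 < \<theta>" "\<theta> \<le> 1 / 2" "\<theta> \<le> \<eta> / (unit_ball_vol (real DIM('a)) * (2 * 6 ^ DIM('a)))"
    using \<eta> by (auto simp: \<theta>_def)
  define D where "D = max 0 (C - \<epsilon>)"
  have iter: "cover_measure g E' \<le> ennreal ((\<epsilon> + D * (1 - \<theta>) ^ N) * measure lebesgue G)"
    if "E' \<subseteq> E" "open G" "E' \<subseteq> G" "G \<in> lmeasurable" for N E' G
    using that
  proof (induction N arbitrary: E' G)
    case 0
    have "cover_measure g E' \<le> ennreal (C * measure lebesgue G)"
      using 0 by (intro crude)
    also have "\<dots> \<le> ennreal ((\<epsilon> + D * (1 - \<theta>) ^ 0) * measure lebesgue G)"
      by (intro ennreal_leI mult_right_mono) (auto simp: D_def)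
    finally show ?case .
  next
    case (Suc N)
    have "0 \<le> D * (1 - \<theta>) ^ N"
      using \<theta> by (simp add: D_def)
    then have "cover_measure g E' \<le> ennreal ((\<epsilon> + D * (1 - \<theta>) ^ N - \<theta> * (\<epsilon> + D * (1 - \<theta>) ^ N - \<epsilon>)) * measure lebesgue G)"
      using Suc.prems by (intro cover_measure_le_volume_step[OF g0 \<eta> \<epsilon> _ slab Suc.IH \<theta>(2,3)]) auto
    also have "\<epsilon> + D * (1 - \<theta>) ^ N - \<theta> * (\<epsilon> + D * (1 - \<theta>) ^ N - \<epsilon>) = \<epsilon> + D * (1 - \<theta>) ^ Suc N"
      by (simp add: algebra_simps)
    finally show ?case .
  qed
  have "(\<lambda>N. ennreal ((\<epsilon> + D * (1 - \<theta>) ^ N) * measure lebesgue G)) \<longlonglongrightarrow>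
      ennreal ((\<epsilon> + D * 0) * measure lebesgue G)"
    using \<theta> by (intro tendsto_ennrealI tendsto_intros LIMSEQ_power_zero) auto
  then have "cover_measure g E \<le> ennreal ((\<epsilon> + D * 0) * measure lebesgue G)"
    using iter[OF order_refl G(2,1,3)] by (intro LIMSEQ_le_const) auto
  then show ?thesis
    by simp
qed

section \<open>Slabs around the kernel of a seminorm\<close>

lemma seminorm_nonneg: "seminorm \<sigma> \<Longrightarrow> 0 \<le> \<sigma> v"
  by (simp add: seminorm_def)

lemma seminorm_scaleR: "seminorm \<sigma> \<Longrightarrow> \<sigma> (c *\<^sub>R v) = \<bar>c\<bar> * \<sigma> v"
  by (simp add: seminorm_def)

lemma seminorm_triangle: "seminorm \<sigma> \<Longrightarrow> \<sigma> (v + w) \<le> \<sigma> v + \<sigma> w"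
  by (simp add: seminorm_def)

lemma seminorm_zero: "seminorm \<sigma> \<Longrightarrow> \<sigma> 0 = 0"
  using seminorm_scaleR[of \<sigma> 0 0] by simp

lemma seminorm_minus: "seminorm \<sigma> \<Longrightarrow> \<sigma> (- v) = \<sigma> v"
  using seminorm_scaleR[of \<sigma> "-1" v] by simp

lemma seminorm_sum_le: "seminorm \<sigma> \<Longrightarrow> \<sigma> (\<Sum>i\<in>I. g i) \<le> (\<Sum>i\<in>I. \<sigma> (g i))"
proof (induction I rule: infinite_finite_induct)
  case (insert i I)
  then show ?case
    using seminorm_triangle[of \<sigma> "g i" "\<Sum>i\<in>I. g i"] by simp
qed (auto simp: seminorm_zero)

lemma seminorm_diff_le: "seminorm \<sigma> \<Longrightarrow> \<bar>\<sigma> v - \<sigma> w\<bar> \<le> \<sigma> (v - w)"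
  using seminorm_triangle[of \<sigma> "v - w" w] seminorm_triangle[of \<sigma> "w - v" v]
    seminorm_minus[of \<sigma> "v - w"] by simp

lemma seminorm_le_norm:
  fixes \<sigma> :: "'a::euclidean_space \<Rightarrow> real"
  assumes "seminorm \<sigma>"
  obtains K where "0 \<le> K" "\<And>v. \<sigma> v \<le> K * norm v"
proof (rule that)
  show "0 \<le> (\<Sum>b\<in>Basis. \<sigma> b)"
    using assms by (intro sum_nonneg seminorm_nonneg)
  fix v :: 'a
  have "\<sigma> v = \<sigma> (\<Sum>b\<in>Basis. (v \<bullet> b) *\<^sub>R b)"
    by (simp add: euclidean_representation)
  also have "\<dots> \<le> (\<Sum>b\<in>Basis. \<sigma> ((v \<bullet> b) *\<^sub>R b))"
    by (rule seminorm_sum_le[OF assms])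
  also have "\<dots> \<le> (\<Sum>b\<in>Basis. norm v * \<sigma> b)"
    using assms Basis_le_norm
    by (intro sum_mono) (auto simp: seminorm_scaleR[OF assms] intro!: mult_right_mono seminorm_nonneg[OF assms])
  also have "\<dots> = (\<Sum>b\<in>Basis. \<sigma> b) * norm v"
    by (simp add: sum_distrib_left mult.commute)
  finally show "\<sigma> v \<le> (\<Sum>b\<in>Basis. \<sigma> b) * norm v" .
qed

lemma continuous_on_seminorm:
  fixes \<sigma> :: "'a::euclidean_space \<Rightarrow> real"
  assumes "seminorm \<sigma>"
  shows "continuous_on S \<sigma>"
proof -
  obtain K where K: "0 \<le> K" "\<And>v. \<sigma> v \<le> K * norm v"
    by (rule seminorm_le_norm[OF assms]) (rule that)
  have "K-lipschitz_on S \<sigma>"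
    using K(1) order_trans[OF seminorm_diff_le[OF assms] K(2)] by (auto intro!: lipschitz_onI simp: dist_norm)
  then show ?thesis
    by (rule lipschitz_on_continuous_on)
qed

lemma subspace_seminorm_kernel:
  assumes \<sigma>: "seminorm \<sigma>"
  shows "subspace {v. \<sigma> v = 0}"
proof (rule subspaceI)
  show "0 \<in> {v. \<sigma> v = 0}"
    by (simp add: seminorm_zero[OF \<sigma>])
  show "v + w \<in> {v. \<sigma> v = 0}" if "v \<in> {v. \<sigma> v = 0}" "w \<in> {v. \<sigma> v = 0}" for v w
    using that seminorm_triangle[OF \<sigma>, of v w] seminorm_nonneg[OF \<sigma>, of "v + w"] by simp
  show "c *\<^sub>R v \<in> {v. \<sigma> v = 0}" if "v \<in> {v. \<sigma> v = 0}" for c v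
    using that by (simp add: seminorm_scaleR[OF \<sigma>])
qed

text \<open>
  A seminorm is unchanged when its kernel is projected away, so it is controlled by the
  coordinates with respect to an orthonormal basis of the orthogonal complement of the kernel.
\<close>
lemma seminorm_le_orthogonal_coordinates:
  fixes \<sigma> :: "'a::euclidean_space \<Rightarrow> real"
  assumes \<sigma>: "seminorm \<sigma>" and K: "\<And>v. \<sigma> v \<le> K * norm v"
  obtains B where "finite B" "card B = seminorm_rank \<sigma>" "\<And>b. b \<in> B \<Longrightarrow> norm b = 1"
    "\<And>v. \<sigma> v \<le> K * (\<Sum>b\<in>B. \<bar>v \<bullet> b\<bar>)"
proof -
  define W where "W = {v. \<sigma> v = 0}"
  define P where "P = {y \<in> UNIV. \<forall>x\<in>W. orthogonal x y}"
  have W: "subspace W"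
    unfolding W_def by (rule subspace_seminorm_kernel[OF \<sigma>])
  have P: "subspace P"
    using subspace_orthogonal_to_vectors[of W] by (simp only: P_def UNIV_I simp_thms)
  have dim: "dim P + dim W = DIM('a)"
    unfolding P_def dim_subspace_orthogonal_to_vectors[OF W subspace_UNIV subset_UNIV] by (rule dim_UNIV)
  obtain B where B: "B \<subseteq> P" "pairwise orthogonal B" "\<And>x. x \<in> B \<Longrightarrow> norm x = 1"
      "independent B" "card B = dim P" "span B = P"
    by (rule orthonormal_basis_subspace[OF P]) (rule that)
  have fin: "finite B"
    using B(4) by (rule independent_imp_finite)
  have inner: "a \<bullet> b = (if a = b then 1 else 0)" if "a \<in> B" "b \<in> B" for a b
    using that B(3)[of a] pairwiseD[OF B(2), of a b] by (auto simp: orthogonal_def norm_eq_1)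
  have "\<sigma> v \<le> K * (\<Sum>b\<in>B. \<bar>v \<bullet> b\<bar>)" for v
  proof -
    define p where "p = (\<Sum>b\<in>B. (v \<bullet> b) *\<^sub>R b)"
    have "(v - p) \<bullet> a = 0" if "a \<in> B" for a
    proof -
      have "p \<bullet> a = (\<Sum>b\<in>B. (v \<bullet> b) * (if b = a then 1 else 0))"
        unfolding p_def inner_sum_left inner_scaleR_left using that
        by (intro sum.cong refl arg_cong2[where f = times] inner)
      also have "\<dots> = (\<Sum>b\<in>B. if b = a then v \<bullet> b else 0)"
        by (intro sum.cong) auto
      also have "\<dots> = v \<bullet> a"
        using fin that by (simp add: sum.delta)
      finally show ?thesis
        by (simp add: inner_diff_left)
    qed
    then have orth: "orthogonal (v - p) y" if "y \<in> P" for y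
      using orthogonal_to_span[of y B "v - p"] that B(6) unfolding orthogonal_def by blast
    obtain w u where wu: "w \<in> span W" "\<And>z. z \<in> span W \<Longrightarrow> orthogonal u z" "v - p = w + u"
      using orthogonal_subspace_decomp_exists[of W "v - p"] by blast
    have "u \<in> P"
      using wu(2)[OF span_base] orthogonal_commute[of u] unfolding P_def by blast
    then have "(v - p) \<bullet> u = 0"
      using orth by (simp add: orthogonal_def)
    moreover have "w \<bullet> u = 0"
      using wu(2)[OF wu(1)] by (simp add: orthogonal_def inner_commute)
    ultimately have "u = 0"
      unfolding wu(3) by (simp add: inner_add_left)
    then have "v - p \<in> W"
      using wu(1) span_eq_iff[THEN iffD2, OF W] unfolding wu(3) by simp
    then have "\<sigma> (v - p) = 0"
      by (simp add: W_def)
    then have "\<sigma> v \<le> \<sigma> p"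
      using seminorm_triangle[OF \<sigma>, of "v - p" p] by simp
    also have "\<dots> \<le> (\<Sum>b\<in>B. \<sigma> ((v \<bullet> b) *\<^sub>R b))"
      unfolding p_def by (rule seminorm_sum_le[OF \<sigma>])
    also have "\<dots> \<le> (\<Sum>b\<in>B. \<bar>v \<bullet> b\<bar> * K)"
    proof (rule sum_mono)
      fix b assume "b \<in> B"
      then have "\<sigma> b \<le> K"
        using K[of b] B(3) by simp
      then show "\<sigma> ((v \<bullet> b) *\<^sub>R b) \<le> \<bar>v \<bullet> b\<bar> * K"
        by (simp add: seminorm_scaleR[OF \<sigma>] mult_left_mono)
    qed
    also have "\<dots> = K * (\<Sum>b\<in>B. \<bar>v \<bullet> b\<bar>)"
      unfolding sum_distrib_left by (intro sum.cong refl mult.commute)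
    finally show ?thesis .
  qed
  note bound = this
  have rank: "card B = seminorm_rank \<sigma>"
    using dim B(5) by (simp add: seminorm_rank_def W_def)
  show thesis
    by (rule that[OF fin rank B(3) bound])
qed

text \<open>
  Sort the points of the ball of radius \<open>r / 2\<close> by their coordinates orthogonal to the kernel,
  rounded to multiples of \<open>h\<close>. Two points with equal rounded coordinates differ by a vector of the
  slab centred at the origin, so the ball is covered by as many translates of the slab as there are
  rounded coordinate vectors. Their number is of order \<open>(1 / \<epsilon>)\<^sup>p\<close>.
\<close>
lemma slab_volume_ge:
  fixes \<sigma> :: "'a::euclidean_space \<Rightarrow> real"
  assumes \<sigma>: "seminorm \<sigma>" and K: "\<And>v. \<sigma> v \<le> K * norm v" and K1: "1 \<le> K"
    and rank: "seminorm_rank \<sigma> \<le> p" and \<epsilon>: "0 < \<epsilon>" "\<epsilon> \<le> 1" and r: "0 < r"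
  shows "unit_ball_vol (real DIM('a)) * (r / 2) ^ DIM('a)
     \<le> (5 * K * (p + 1) / \<epsilon>) ^ p * measure lebesgue {y \<in> cball x r. \<sigma> (y - x) \<le> \<epsilon> * r}"
proof -
  obtain B where B: "finite B" "card B = seminorm_rank \<sigma>" "\<And>b. b \<in> B \<Longrightarrow> norm b = 1"
    "\<And>v. \<sigma> v \<le> K * (\<Sum>b\<in>B. \<bar>v \<bullet> b\<bar>)"
    by (rule seminorm_le_orthogonal_coordinates[OF \<sigma> K]) (rule that)
  \<comment> \<open>Chosen so that at most \<open>p\<close> coordinates of size at most \<open>h\<close> give seminorm at most \<open>\<epsilon> * r\<close>;
    \<open>p + 1\<close> avoids a division by zero.\<close>
  define h where "h = \<epsilon> * r / (K * (p + 1))"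
  have h: "0 < h"
    using \<epsilon> r K1 by (simp add: h_def)
  define S where "S = {v \<in> cball 0 r. \<sigma> v \<le> \<epsilon> * r}"
  have "closed S"
    unfolding S_def
    by (intro closed_Collect_conj[of "\<lambda>v. v \<in> cball 0 r", simplified Collect_mem_eq] closed_Collect_le
        continuous_on_seminorm[OF \<sigma>] continuous_intros) auto
  then have S: "S \<in> lmeasurable"
    using bounded_subset[OF bounded_cball[of 0 r], of S]
    by (intro lmeasurable_compact) (auto simp: compact_eq_bounded_closed subset_eq S_def)
  define M where "M = \<lceil>r / (2 * h)\<rceil>"
  define code where "code y = restrict (\<lambda>b. \<lfloor>((y - x) \<bullet> b) / h\<rfloor>) B" for y
  define T where "T = code ` cball x (r / 2)"
  have "T \<subseteq> PiE B (\<lambda>_. {- M..M})"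
  proof
    fix t assume "t \<in> T"
    then obtain y where y: "y \<in> cball x (r / 2)" "t = code y"
      by (auto simp: T_def)
    have "- M \<le> \<lfloor>((y - x) \<bullet> b) / h\<rfloor> \<and> \<lfloor>((y - x) \<bullet> b) / h\<rfloor> \<le> M" if "b \<in> B" for b
    proof -
      have "\<bar>(y - x) \<bullet> b\<bar> \<le> norm (y - x) * norm b"
        by (rule Cauchy_Schwarz_ineq2)
      also have "\<dots> \<le> r / 2"
        using y B(3)[OF that] by (simp add: dist_norm norm_minus_commute)
      finally have "\<bar>((y - x) \<bullet> b) / h\<bar> \<le> r / (2 * h)"
        using h by (simp add: field_simps)
      then have "\<bar>((y - x) \<bullet> b) / h\<bar> \<le> of_int M"
        unfolding M_def by (meson le_of_int_ceiling order_trans)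
      then have "- of_int M \<le> ((y - x) \<bullet> b) / h" "((y - x) \<bullet> b) / h \<le> of_int M"
        by (simp_all only: abs_le_iff) auto
      then show ?thesis
        by (simp add: le_floor_iff floor_le_iff)
    qed
    then show "t \<in> PiE B (\<lambda>_. {- M..M})"
      using y(2) by (auto simp: code_def)
  qed
  then have finT: "finite T" and "card T \<le> card (PiE B (\<lambda>_. {- M..M}))"
    using B(1) by (auto intro: finite_subset card_mono finite_PiE)
  then have "card T \<le> nat (2 * M + 1) ^ card B"
    using B(1) by (simp add: card_PiE)
  then have "real (card T) \<le> real (nat (2 * M + 1)) ^ card B"
    by (metis of_nat_le_iff of_nat_power)
  also have "\<dots> \<le> (5 * K * (p + 1) / \<epsilon>) ^ card B"
  proof (rule power_mono)
    have "0 \<le> r / (2 * h)"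
      using r h by simp
    then have M0: "0 \<le> M"
      unfolding M_def by linarith
    have "1 * 1 \<le> K * (p + 1)"
      using K1 by (intro mult_mono) auto
    then have big: "1 \<le> K * (p + 1) / \<epsilon>"
      using \<epsilon> by (simp add: field_simps)
    have "of_int M \<le> r / (2 * h) + 1"
      unfolding M_def by linarith
    also have "r / (2 * h) = K * (p + 1) / \<epsilon> / 2"
      using r by (simp add: h_def)
    finally have "2 * of_int M + 1 \<le> K * (p + 1) / \<epsilon> + 3"
      by simp
    also have "\<dots> \<le> 5 * (K * (p + 1) / \<epsilon>)"
      using big by linarith
    finally show "real (nat (2 * M + 1)) \<le> 5 * K * (p + 1) / \<epsilon>"
      using M0 by (simp add: mult.assoc)
  qed auto
  also have "\<dots> \<le> (5 * K * (p + 1) / \<epsilon>) ^ p"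
  proof (rule power_increasing)
    have "1 * 1 \<le> 5 * K * (p + 1)"
      using K1 by (intro mult_mono) auto
    then show "1 \<le> 5 * K * (p + 1) / \<epsilon>"
      using \<epsilon> by (simp add: field_simps)
  qed (use B(2) rank in simp)
  finally have cardT: "real (card T) \<le> (5 * K * (p + 1) / \<epsilon>) ^ p" .
  define rep where "rep t = (SOME y. y \<in> cball x (r / 2) \<and> code y = t)" for t
  have rep: "rep t \<in> cball x (r / 2) \<and> code (rep t) = t" if "t \<in> T" for t
    unfolding rep_def by (rule someI_ex) (use that in \<open>auto simp: T_def\<close>)
  have cover: "cball x (r / 2) \<subseteq> (\<Union>t\<in>T. (+) (rep t) ` S)"
  proof
    fix y assume y: "y \<in> cball x (r / 2)"
    define t where "t = code y"
    define z where "z = rep t"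
    have tT: "t \<in> T"
      using y by (simp add: T_def t_def)
    have z: "z \<in> cball x (r / 2)" "code z = code y"
      using rep[OF tT] by (auto simp: z_def t_def)
    have "norm (y - z) \<le> r"
      using y z(1) dist_triangle3[of y z x] by (simp add: dist_norm)
    moreover have "\<sigma> (y - z) \<le> \<epsilon> * r"
    proof -
      have "\<bar>(y - z) \<bullet> b\<bar> \<le> h" if "b \<in> B" for b
      proof -
        have "\<lfloor>((y - x) \<bullet> b) / h\<rfloor> = \<lfloor>((z - x) \<bullet> b) / h\<rfloor>"
          using fun_cong[OF z(2), of b] that by (simp add: code_def)
        then have "\<bar>((y - x) \<bullet> b) / h - ((z - x) \<bullet> b) / h\<bar> \<le> 1"
          by linarith
        then show ?thesis
          using h by (simp add: diff_divide_distrib[symmetric] inner_diff_left[symmetric])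
      qed
      then have "(\<Sum>b\<in>B. \<bar>(y - z) \<bullet> b\<bar>) \<le> card B * h"
        by (rule sum_bounded_above)
      also have "\<dots> \<le> (p + 1) * h"
        using B(2) rank h by (intro mult_right_mono) auto
      finally have "K * (\<Sum>b\<in>B. \<bar>(y - z) \<bullet> b\<bar>) \<le> K * ((p + 1) * h)"
        using K1 by (intro mult_left_mono) auto
      also have "\<dots> = \<epsilon> * r"
        using K1 by (simp add: h_def)
      finally show ?thesis
        using B(4)[of "y - z"] by simp
    qed
    ultimately have "y - z \<in> S"
      by (simp add: S_def)
    then have "y \<in> (+) (rep t) ` S"
      unfolding z_def by (intro image_eqI[of _ _ "y - rep t"]) auto
    then show "y \<in> (\<Union>t\<in>T. (+) (rep t) ` S)"
      using tT by blast
  qed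
  have "unit_ball_vol (real DIM('a)) * (r / 2) ^ DIM('a) = measure lebesgue (cball x (r / 2))"
    using r content_cball[of "r / 2" x] by simp
  also have "\<dots> \<le> measure lebesgue (\<Union>t\<in>T. (+) (rep t) ` S)"
    using cover finT S by (intro measure_mono_fmeasurable fmeasurable.finite_UN measurable_translation) auto
  also have "\<dots> \<le> (\<Sum>t\<in>T. measure lebesgue ((+) (rep t) ` S))"
    using finT S by (intro measure_UNION_le) (auto intro!: fmeasurableD measurable_translation)
  also have "\<dots> = real (card T) * measure lebesgue S"
    by (simp add: measure_translation)
  also have "\<dots> \<le> (5 * K * (p + 1) / \<epsilon>) ^ p * measure lebesgue S"
    using cardT by (intro mult_right_mono) auto
  also have "measure lebesgue S = measure lebesgue ((+) x ` S)"
    by (simp add: measure_translation)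
  also have "(+) x ` S = {y \<in> cball x r. \<sigma> (y - x) \<le> \<epsilon> * r}"
  proof (intro set_eqI iffI)
    fix y assume "y \<in> {y \<in> cball x r. \<sigma> (y - x) \<le> \<epsilon> * r}"
    then show "y \<in> (+) x ` S"
      by (intro image_eqI[of _ _ "y - x"]) (auto simp: S_def dist_norm norm_minus_commute)
  qed (auto simp: S_def dist_norm)
  finally show ?thesis .
qed

section \<open>Approximate metric derivatives of Lipschitz maps\<close>

text \<open>
  If \<open>S\<close> missed a ball of radius \<open>\<epsilon> r\<close> inside the ball of radius \<open>2r\<close> about \<open>x\<close>, then its relative
  measure in the latter would be at most \<open>1 - (\<epsilon> / 2)\<^sup>n\<close>, where \<open>n\<close> is the dimension.
\<close>
lemma density_point_nearby:
  fixes x :: "'a::euclidean_space"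
  assumes S: "S \<in> sets lebesgue" and x: "lebesgue_density_point S x" and \<epsilon>: "0 < \<epsilon>" "\<epsilon> \<le> 1"
  obtains \<rho> where "0 < \<rho>" "\<And>r y. 0 < r \<Longrightarrow> r < \<rho> \<Longrightarrow> y \<in> cball x r \<Longrightarrow> \<exists>z\<in>S. dist z y < \<epsilon> * r"
proof -
  define n where "n = DIM('a)"
  define \<omega> where "\<omega> = unit_ball_vol (real n)"
  have \<omega>: "0 < \<omega>"
    by (simp add: \<omega>_def)
  have ball: "measure lebesgue (ball y s) = \<omega> * s ^ n" if "0 \<le> s" for y :: 'a and s
    using content_ball[OF that, of y] by (simp add: \<omega>_def n_def)
  have "1 - (\<epsilon> / 2) ^ n < 1"
    using \<epsilon> by simp
  then have "eventually (\<lambda>r. 1 - (\<epsilon> / 2) ^ n < measure lebesgue (S \<inter> ball x r) / measure lebesgue (ball x r)) (at_right 0)"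
    using x unfolding lebesgue_density_point_def by (rule order_tendstoD(1)[rotated])
  then obtain \<rho> where \<rho>: "0 < \<rho>"
    "\<And>s. 0 < s \<Longrightarrow> s < \<rho> \<Longrightarrow> 1 - (\<epsilon> / 2) ^ n < measure lebesgue (S \<inter> ball x s) / measure lebesgue (ball x s)"
    unfolding eventually_at_right_field by auto
  show thesis
  proof (rule that[of "\<rho> / 2"])
    fix r y assume r: "0 < r" "r < \<rho> / 2" and y: "y \<in> cball x r"
    show "\<exists>z\<in>S. dist z y < \<epsilon> * r"
    proof (rule ccontr)
      assume none: "\<not> ?thesis"
      have small: "\<epsilon> * r \<le> 1 * r"
        using \<epsilon> r by (intro mult_right_mono) auto
      have sub: "ball y (\<epsilon> * r) \<subseteq> ball x (2 * r)"
      proof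
        fix z assume "z \<in> ball y (\<epsilon> * r)"
        then show "z \<in> ball x (2 * r)"
          using y small dist_triangle[of x z y] by simp
      qed
      have "measure lebesgue (S \<inter> ball x (2 * r)) \<le> measure lebesgue (ball x (2 * r) - ball y (\<epsilon> * r))"
      proof (rule measure_mono_fmeasurable)
        show "S \<inter> ball x (2 * r) \<subseteq> ball x (2 * r) - ball y (\<epsilon> * r)"
          using none by (auto simp: dist_commute)
      qed (use S in \<open>auto intro!: fmeasurable_Diff\<close>)
      also have "\<dots> = measure lebesgue (ball x (2 * r)) - measure lebesgue (ball y (\<epsilon> * r))"
        using sub by (intro measurable_measure_Diff) auto
      also have "\<dots> = \<omega> * (2 * r) ^ n - \<omega> * (\<epsilon> * r) ^ n"
        using r \<epsilon> by (simp only: ball mult_nonneg_nonneg less_imp_le zero_le_numeral)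
      also have "\<dots> = (1 - (\<epsilon> / 2) ^ n) * (\<omega> * (2 * r) ^ n)"
        by (simp add: algebra_simps power_mult_distrib power_divide)
      finally have "measure lebesgue (S \<inter> ball x (2 * r)) / measure lebesgue (ball x (2 * r)) \<le> 1 - (\<epsilon> / 2) ^ n"
        using r \<omega> by (subst ball[of "2 * r" x]) (simp_all add: pos_divide_le_eq)
      then show False
        using \<rho>(2)[of "2 * r"] r by simp
    qed
  qed (use \<rho> in simp)
qed

text \<open>
  For Lipschitz maps the approximate expansion is an expansion along all of \<open>A\<close>: every point \<open>y\<close>
  near \<open>x\<close> has a point of the density set within a small fraction of \<open>dist y x\<close>, and both
  \<open>f\<close> and \<open>\<sigma>\<close> change little between the two.
\<close>
lemma lipschitz_approx_metric_derivative:
  fixes f :: "'a::euclidean_space \<Rightarrow> 'b::metric_space"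
  assumes f: "L-lipschitz_on A f" and x: "x \<in> A"
    and der: "has_approx_metric_derivative f A x \<sigma>" and \<epsilon>: "0 < \<epsilon>"
  obtains \<rho> where "0 < \<rho>"
    "\<And>y. y \<in> A \<Longrightarrow> dist y x < \<rho> \<Longrightarrow> \<bar>dist (f y) (f x) - \<sigma> (y - x)\<bar> \<le> \<epsilon> * dist y x"
proof -
  have \<sigma>: "seminorm \<sigma>"
    using der by (simp add: has_approx_metric_derivative_def)
  obtain S where S: "S \<in> sets lebesgue" "S \<subseteq> A" "lebesgue_density_point S x"
    and lim: "((\<lambda>y. (dist (f y) (f x) - \<sigma> (y - x)) / norm (y - x)) \<longlongrightarrow> 0) (at x within S)"
    using der by (auto simp: has_approx_metric_derivative_def)
  obtain K where K: "0 \<le> K" "\<And>v. \<sigma> v \<le> K * norm v"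
    by (rule seminorm_le_norm[OF \<sigma>]) (rule that)
  have L: "0 \<le> L"
    using f by (rule lipschitz_on_nonneg)
  define \<tau> where "\<tau> = min 1 (\<epsilon> / (L + K + 2))"
  have \<tau>: "0 < \<tau>" "\<tau> \<le> 1"
    using \<epsilon> L K by (auto simp: \<tau>_def)
  have "\<tau> \<le> \<epsilon> / (L + K + 2)"
    by (simp add: \<tau>_def)
  then have \<tau>\<epsilon>: "(L + K + 2) * \<tau> \<le> \<epsilon>"
    using L K by (simp add: pos_le_divide_eq mult.commute)
  obtain d where d: "0 < d" "\<And>y. y \<in> S \<Longrightarrow> y \<noteq> x \<Longrightarrow> dist y x < d \<Longrightarrow>
      \<bar>(dist (f y) (f x) - \<sigma> (y - x)) / norm (y - x)\<bar> < \<tau>"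
    using tendstoD[OF lim \<tau>(1)] unfolding eventually_at by (auto simp: dist_real_def)
  have near: "\<bar>dist (f y) (f x) - \<sigma> (y - x)\<bar> \<le> \<tau> * dist y x" if "y \<in> S" "dist y x < d" for y
  proof (cases "y = x")
    case False
    then show ?thesis
      using d(2)[OF that(1) False that(2)] by (simp add: dist_norm pos_divide_less_eq abs_divide)
  qed (simp add: seminorm_zero[OF \<sigma>])
  obtain \<rho>1 where \<rho>1: "0 < \<rho>1"
    "\<And>r y. 0 < r \<Longrightarrow> r < \<rho>1 \<Longrightarrow> y \<in> cball x r \<Longrightarrow> \<exists>z\<in>S. dist z y < \<tau> * r"
    by (rule density_point_nearby[OF S(1,3) \<tau>]) (rule that)
  show thesis
  proof (rule that[of "min \<rho>1 (d / 2)"])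
    fix y assume y: "y \<in> A" "dist y x < min \<rho>1 (d / 2)"
    define r where "r = dist y x"
    show "\<bar>dist (f y) (f x) - \<sigma> (y - x)\<bar> \<le> \<epsilon> * dist y x"
    proof (cases "y = x")
      case False
      then have r: "0 < r"
        by (simp add: r_def)
      obtain z where z: "z \<in> S" "dist z y < \<tau> * r"
        using \<rho>1(2)[OF r, of y] y by (auto simp: r_def dist_commute)
      have "\<tau> * r \<le> 1 * r"
        using \<tau> r by (intro mult_right_mono) auto
      then have zx: "dist z x \<le> 2 * r"
        using z(2) dist_triangle[of z x y] by (simp add: r_def)
      have "dist z x < d"
        using zx y(2) by (simp add: r_def)
      then have "\<bar>dist (f z) (f x) - \<sigma> (z - x)\<bar> \<le> \<tau> * dist z x"
        using near z(1) by blast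
      also have "\<dots> \<le> \<tau> * (2 * r)"
        using zx \<tau> by (intro mult_left_mono) auto
      finally have 1: "\<bar>dist (f z) (f x) - \<sigma> (z - x)\<bar> \<le> \<tau> * (2 * r)" .
      have "\<bar>dist (f y) (f x) - dist (f z) (f x)\<bar> \<le> dist (f z) (f y)"
        by (smt (verit) dist_commute dist_triangle)
      also have "\<dots> \<le> L * dist z y"
        using z S y by (intro lipschitz_onD[OF f]) auto
      also have "\<dots> \<le> L * (\<tau> * r)"
        using z(2) L by (intro mult_left_mono) auto
      finally have 2: "\<bar>dist (f y) (f x) - dist (f z) (f x)\<bar> \<le> L * (\<tau> * r)" .
      have "\<bar>\<sigma> (z - x) - \<sigma> (y - x)\<bar> \<le> \<sigma> (z - y)"
        using seminorm_diff_le[OF \<sigma>, of "z - x" "y - x"] by simp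
      also have "\<dots> \<le> K * dist z y"
        using K(2) by (simp add: dist_norm)
      also have "\<dots> \<le> K * (\<tau> * r)"
        using z(2) K by (intro mult_left_mono) auto
      finally have 3: "\<bar>\<sigma> (z - x) - \<sigma> (y - x)\<bar> \<le> K * (\<tau> * r)" .
      have "\<bar>dist (f y) (f x) - \<sigma> (y - x)\<bar> \<le> \<tau> * (2 * r) + L * (\<tau> * r) + K * (\<tau> * r)"
        using 1 2 3 by linarith
      also have "\<dots> = ((L + K + 2) * \<tau>) * r"
        by (simp add: algebra_simps)
      also have "\<dots> \<le> \<epsilon> * r"
        using \<tau>\<epsilon> r by (intro mult_right_mono) auto
      finally show ?thesis
        by (simp add: r_def)
    qed (simp add: seminorm_zero[OF \<sigma>])
  qed (use \<rho>1 d in simp)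
qed

text \<open>
  Both seminorms approximate \<open>dist (f z) (f x)\<close> at the same points \<open>z \<in> A\<close> near \<open>x\<close>, and every
  direction \<open>v\<close> is approximated by directions \<open>z - x\<close> with \<open>z\<close> in the density set.
\<close>
lemma approx_metric_derivative_unique:
  fixes f :: "'a::euclidean_space \<Rightarrow> 'b::metric_space"
  assumes f: "L-lipschitz_on A f" and x: "x \<in> A"
    and \<sigma>: "has_approx_metric_derivative f A x \<sigma>" and \<sigma>': "has_approx_metric_derivative f A x \<sigma>'"
  shows "\<sigma> = \<sigma>'"
proof (rule ext, rule ccontr)
  fix v assume ne: "\<sigma> v \<noteq> \<sigma>' v"
  have sn: "seminorm \<sigma>" "seminorm \<sigma>'"
    using \<sigma> \<sigma>' by (auto simp: has_approx_metric_derivative_def)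
  have v: "v \<noteq> 0"
    using ne sn by (auto simp: seminorm_zero)
  obtain S where S: "S \<in> sets lebesgue" "S \<subseteq> A" "lebesgue_density_point S x"
    using \<sigma> by (auto simp: has_approx_metric_derivative_def)
  obtain K where K: "0 \<le> K" "\<And>v. \<sigma> v \<le> K * norm v"
    by (rule seminorm_le_norm[OF sn(1)]) (rule that)
  obtain K' where K': "0 \<le> K'" "\<And>v. \<sigma>' v \<le> K' * norm v"
    by (rule seminorm_le_norm[OF sn(2)]) (rule that)
  define M where "M = K + K' + 4"
  have M: "0 < M"
    using K K' by (simp add: M_def)
  \<comment> \<open>Small enough that an error of \<open>M * \<epsilon> * norm v\<close> is at most half of the supposed difference.\<close>
  define \<epsilon> where "\<epsilon> = min 1 (\<bar>\<sigma> v - \<sigma>' v\<bar> / (2 * M * norm v))"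
  have \<epsilon>: "0 < \<epsilon>" "\<epsilon> \<le> 1"
    using ne v M by (auto simp: \<epsilon>_def)
  have "\<epsilon> \<le> \<bar>\<sigma> v - \<sigma>' v\<bar> / (2 * M * norm v)"
    by (simp add: \<epsilon>_def)
  then have \<epsilon>2: "2 * (M * \<epsilon> * norm v) \<le> \<bar>\<sigma> v - \<sigma>' v\<bar>"
    using v M by (simp add: pos_le_divide_eq mult_ac)
  obtain \<rho>1 where \<rho>1: "0 < \<rho>1"
    "\<And>y. y \<in> A \<Longrightarrow> dist y x < \<rho>1 \<Longrightarrow> \<bar>dist (f y) (f x) - \<sigma> (y - x)\<bar> \<le> \<epsilon> * dist y x"
    by (rule lipschitz_approx_metric_derivative[OF f x \<sigma> \<epsilon>(1)]) (rule that)
  obtain \<rho>2 where \<rho>2: "0 < \<rho>2"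
    "\<And>y. y \<in> A \<Longrightarrow> dist y x < \<rho>2 \<Longrightarrow> \<bar>dist (f y) (f x) - \<sigma>' (y - x)\<bar> \<le> \<epsilon> * dist y x"
    by (rule lipschitz_approx_metric_derivative[OF f x \<sigma>' \<epsilon>(1)]) (rule that)
  obtain \<rho>3 where \<rho>3: "0 < \<rho>3"
    "\<And>r y. 0 < r \<Longrightarrow> r < \<rho>3 \<Longrightarrow> y \<in> cball x r \<Longrightarrow> \<exists>z\<in>S. dist z y < \<epsilon> * r"
    by (rule density_point_nearby[OF S(1,3) \<epsilon>]) (rule that)
  define r where "r = min (min \<rho>1 \<rho>2) \<rho>3 / 4"
  have r: "0 < r" "2 * r < \<rho>1" "2 * r < \<rho>2" "r < \<rho>3"
    using \<rho>1(1) \<rho>2(1) \<rho>3(1) by (auto simp: r_def)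
  define u where "u = (r / norm v) *\<^sub>R v"
  have u: "norm u = r"
    using v r by (simp add: u_def)
  have "x + u \<in> cball x r"
    using u by (simp add: dist_norm)
  then obtain z where z: "z \<in> S" "dist z (x + u) < \<epsilon> * r"
    using \<rho>3(2)[OF r(1,4)] by blast
  have "\<epsilon> * r \<le> 1 * r"
    using \<epsilon> r by (intro mult_right_mono) auto
  then have zx: "dist z x \<le> 2 * r"
    using z(2) dist_triangle[of z x "x + u"] u by (simp add: dist_norm)
  have "z \<in> A"
    using z S by blast
  have le: "\<epsilon> * dist z x \<le> \<epsilon> * (2 * r)"
    using zx \<epsilon> by (intro mult_left_mono) auto
  have 1: "\<bar>\<sigma> (z - x) - \<sigma>' (z - x)\<bar> \<le> \<epsilon> * (2 * r) + \<epsilon> * (2 * r)"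
    using \<rho>1(2)[OF \<open>z \<in> A\<close>] \<rho>2(2)[OF \<open>z \<in> A\<close>] zx r(2,3) le by linarith
  have zu: "norm (u - (z - x)) \<le> \<epsilon> * r"
    using z(2) by (simp add: dist_norm norm_minus_commute algebra_simps)
  have 2: "\<bar>\<sigma> u - \<sigma> (z - x)\<bar> \<le> K * (\<epsilon> * r)"
    using seminorm_diff_le[OF sn(1), of u "z - x"] K(2)[of "u - (z - x)"] mult_left_mono[OF zu K(1)]
    by linarith
  have 3: "\<bar>\<sigma>' u - \<sigma>' (z - x)\<bar> \<le> K' * (\<epsilon> * r)"
    using seminorm_diff_le[OF sn(2), of u "z - x"] K'(2)[of "u - (z - x)"] mult_left_mono[OF zu K'(1)]
    by linarith
  have "\<bar>\<sigma> u - \<sigma>' u\<bar> \<le> K * (\<epsilon> * r) + K' * (\<epsilon> * r) + (\<epsilon> * (2 * r) + \<epsilon> * (2 * r))"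
    using 1 2 3 by linarith
  also have "\<dots> = M * \<epsilon> * r"
    by (simp add: M_def algebra_simps)
  finally have "\<bar>\<sigma> u - \<sigma>' u\<bar> \<le> M * \<epsilon> * r" .
  moreover have "\<sigma> u - \<sigma>' u = r / norm v * (\<sigma> v - \<sigma>' v)"
    using r v by (simp add: u_def seminorm_scaleR[OF sn(1)] seminorm_scaleR[OF sn(2)] right_diff_distrib)
  ultimately have "r / norm v * \<bar>\<sigma> v - \<sigma>' v\<bar> \<le> M * \<epsilon> * r"
    using r v by (simp add: abs_mult)
  then have "r * \<bar>\<sigma> v - \<sigma>' v\<bar> \<le> r * (M * \<epsilon> * norm v)"
    using v by (simp add: field_simps)
  then have "\<bar>\<sigma> v - \<sigma>' v\<bar> \<le> M * \<epsilon> * norm v"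
    using r by simp
  moreover have "0 < M * \<epsilon> * norm v"
    using M \<epsilon> v by simp
  ultimately show False
    using \<epsilon>2 by linarith
qed

lemma approx_metric_derivative_eqI:
  assumes "L-lipschitz_on A f" "x \<in> A" "has_approx_metric_derivative f A x \<sigma>"
  shows "approx_metric_derivative f A x = \<sigma>"
  unfolding approx_metric_derivative_def
proof (rule the_equality)
  show "\<tau> = \<sigma>" if "has_approx_metric_derivative f A x \<tau>" for \<tau>
    by (rule approx_metric_derivative_unique[OF assms(1,2) that assms(3)])
qed (rule assms(3))

section \<open>Critical points are negligible for the coarea covers\<close>

text \<open>
  Where the rank is below \<open>m\<close>, slabs are cheap: the image of the slab has diameter of order
  \<open>\<epsilon> r\<close>, which contributes \<open>\<epsilon>\<^sup>m\<close> to the cost, whereas the volume of the slab loses only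
  \<open>\<epsilon>\<^sup>m\<^sup>-\<^sup>1\<close>. The quotient of cost and volume retains one factor \<open>\<epsilon>\<close>.
\<close>
lemma critical_slab:
  fixes f :: "'a::euclidean_space \<Rightarrow> 'b::metric_space"
  assumes f: "L-lipschitz_on A f" and dim: "DIM('a) = k + m" and m: "0 < m" and \<delta>: "0 < \<delta>"
    and x: "x \<in> A" and der: "has_approx_metric_derivative f A x \<sigma>" and rank: "seminorm_rank \<sigma> < m"
    and K: "\<And>v. \<sigma> v \<le> K * norm v" "1 \<le> K" and \<epsilon>: "0 < \<epsilon>" "\<epsilon> \<le> 1" and E: "E \<subseteq> A"
  defines "V \<equiv> unit_ball_vol (real DIM('a)) / 2 ^ DIM('a)"
  shows "\<exists>\<rho>>0. \<forall>r. 0 < r \<and> r < \<rho> \<longrightarrow>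
      (\<exists>S. closed S \<and> S \<subseteq> cball x r \<and>
           V / (5 * K * m / \<epsilon>) ^ (m - 1) * r ^ DIM('a) \<le> measure lebesgue S \<and>
           cover_measure (coarea_gauge f k m \<delta>) (S \<inter> E)
             \<le> ennreal (2 ^ k * 4 ^ m * (5 * K * m) ^ (m - 1) / V * \<epsilon> * measure lebesgue S))"
proof -
  have \<sigma>: "seminorm \<sigma>"
    using der by (simp add: has_approx_metric_derivative_def)
  have V: "0 < V"
    by (simp add: V_def)
  obtain \<rho> where \<rho>: "0 < \<rho>"
    "\<And>y. y \<in> A \<Longrightarrow> dist y x < \<rho> \<Longrightarrow> \<bar>dist (f y) (f x) - \<sigma> (y - x)\<bar> \<le> \<epsilon> * dist y x"
    by (rule lipschitz_approx_metric_derivative[OF f x der \<epsilon>(1)]) (rule that)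
  show ?thesis
  proof (intro exI[of _ "min \<rho> (\<delta> / 4)"] conjI allI impI)
    show "0 < min \<rho> (\<delta> / 4)"
      using \<rho> \<delta> by simp
    fix r assume "0 < r \<and> r < min \<rho> (\<delta> / 4)"
    then have r: "0 < r" "r < \<rho>" "4 * r \<le> \<delta>"
      by auto
    have \<epsilon>r: "0 < \<epsilon> * r" "\<epsilon> * r \<le> 1 * r"
      using \<epsilon> r by (auto intro!: mult_right_mono simp del: mult_1)
    define S where "S = {y \<in> cball x r. \<sigma> (y - x) \<le> \<epsilon> * r}"
    have "closed S"
      unfolding S_def
      by (intro closed_Collect_conj[of "\<lambda>v. v \<in> cball x r", simplified Collect_mem_eq] closed_Collect_le
          continuous_on_compose2[OF continuous_on_seminorm[OF \<sigma>, of UNIV]] continuous_intros) auto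
    have "seminorm_rank \<sigma> \<le> m - 1"
      using rank by simp
    then have "unit_ball_vol (real DIM('a)) * (r / 2) ^ DIM('a)
        \<le> (5 * K * real (m - 1 + 1) / \<epsilon>) ^ (m - 1) * measure lebesgue S"
      unfolding S_def by (intro slab_volume_ge[OF \<sigma> K _ \<epsilon> r(1), of "m - 1" x]) 
    then have vol: "V * r ^ DIM('a) \<le> (5 * K * m / \<epsilon>) ^ (m - 1) * measure lebesgue S"
      using m by (simp add: V_def power_divide)
    have pos: "0 < (5 * K * m / \<epsilon>) ^ (m - 1)"
      using K(2) m \<epsilon> by simp
    have "coarea_gauge f k m \<delta> (S \<inter> E) \<le> ennreal ((2 * r) ^ k * (4 * (\<epsilon> * r)) ^ m)"
    proof (rule coarea_gauge_le)
      fix y z assume yz: "y \<in> S \<inter> E" "z \<in> S \<inter> E"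
      have near: "dist (f w) (f x) \<le> 2 * (\<epsilon> * r)" if "w \<in> S \<inter> E" for w
      proof -
        have w: "w \<in> A" "dist w x \<le> r" "\<sigma> (w - x) \<le> \<epsilon> * r"
          using that E by (auto simp: S_def dist_commute)
        then have "\<bar>dist (f w) (f x) - \<sigma> (w - x)\<bar> \<le> \<epsilon> * dist w x"
          using r by (intro \<rho>(2)) auto
        also have "\<dots> \<le> \<epsilon> * r"
          using w \<epsilon> by (intro mult_left_mono) auto
        finally show ?thesis
          using w(3) by linarith
      qed
      show "dist (f y) (f z) \<le> 4 * (\<epsilon> * r)"
        using near[OF yz(1)] near[OF yz(2)] dist_triangle2[of "f y" "f z" "f x"] by linarith
      show "dist y z \<le> 2 * r"
        using yz dist_triangle3[of y z x] by (auto simp: S_def)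
    qed (use r \<epsilon>r in auto)
    then have "cover_measure (coarea_gauge f k m \<delta>) (S \<inter> E) \<le> ennreal ((2 * r) ^ k * (4 * (\<epsilon> * r)) ^ m)"
      using cover_measure_le_gauge[of "coarea_gauge f k m \<delta>" "S \<inter> E"] by (auto intro: order_trans)
    also have "\<dots> \<le> ennreal (2 ^ k * 4 ^ m * (5 * K * m) ^ (m - 1) / V * \<epsilon> * measure lebesgue S)"
    proof (rule ennreal_leI)
      have "(2 * r) ^ k * (4 * (\<epsilon> * r)) ^ m = 2 ^ k * 4 ^ m * \<epsilon> ^ m / V * (V * r ^ DIM('a))"
        using V by (simp add: dim power_add power_mult_distrib)
      also have "\<dots> \<le> 2 ^ k * 4 ^ m * \<epsilon> ^ m / V * ((5 * K * m / \<epsilon>) ^ (m - 1) * measure lebesgue S)"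
        using V \<epsilon> vol by (intro mult_left_mono) auto
      also have "\<epsilon> ^ m = \<epsilon> * \<epsilon> ^ (m - 1)"
        using m by (simp add: power_eq_if)
      also have "2 ^ k * 4 ^ m * (\<epsilon> * \<epsilon> ^ (m - 1)) / V * ((5 * K * m / \<epsilon>) ^ (m - 1) * measure lebesgue S)
          = 2 ^ k * 4 ^ m * (5 * K * m) ^ (m - 1) / V * \<epsilon> * measure lebesgue S"
        using \<epsilon>(1) by (simp add: power_divide)
      finally show "(2 * r) ^ k * (4 * (\<epsilon> * r)) ^ m
          \<le> 2 ^ k * 4 ^ m * (5 * K * m) ^ (m - 1) / V * \<epsilon> * measure lebesgue S" .
    qed
    finally have cost: "cover_measure (coarea_gauge f k m \<delta>) (S \<inter> E)
        \<le> ennreal (2 ^ k * 4 ^ m * (5 * K * m) ^ (m - 1) / V * \<epsilon> * measure lebesgue S)" .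
    have "V / (5 * K * m / \<epsilon>) ^ (m - 1) * r ^ DIM('a) \<le> measure lebesgue S"
      using vol unfolding times_divide_eq_left pos_divide_le_eq[OF pos] by (subst (2) mult.commute)
    then show "\<exists>S. closed S \<and> S \<subseteq> cball x r \<and>
           V / (5 * K * m / \<epsilon>) ^ (m - 1) * r ^ DIM('a) \<le> measure lebesgue S \<and>
           cover_measure (coarea_gauge f k m \<delta>) (S \<inter> E)
             \<le> ennreal (2 ^ k * 4 ^ m * (5 * K * m) ^ (m - 1) / V * \<epsilon> * measure lebesgue S)"
      using cost \<open>closed S\<close> by (intro exI[of _ S]) (auto simp: S_def)
  qed
qed

lemma critical_coarea_null:
  fixes f :: "'a::euclidean_space \<Rightarrow> 'b::metric_space"
  assumes f: "L-lipschitz_on A f" and dim: "DIM('a) = k + m" and m: "0 < m" and \<delta>: "0 < \<delta>"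
    and E: "E \<subseteq> A" "E \<subseteq> ball 0 R" and K: "1 \<le> K"
    and crit: "\<And>x. x \<in> E \<Longrightarrow> \<exists>\<sigma>. has_approx_metric_derivative f A x \<sigma> \<and> seminorm_rank \<sigma> < m \<and>
        (\<forall>v. \<sigma> v \<le> K * norm v)"
  shows "cover_measure (coarea_gauge f k m \<delta>) E = 0"
proof -
  define V where "V = unit_ball_vol (real DIM('a)) / 2 ^ DIM('a)"
  define Q where "Q = 2 ^ k * 4 ^ m * (5 * K * m) ^ (m - 1) / V"
  define M where "M = measure lebesgue (ball 0 R :: 'a set)"
  have V: "0 < V"
    by (simp add: V_def)
  have Q: "0 \<le> Q"
    using V K by (simp add: Q_def)
  have M: "0 \<le> M"
    by (simp add: M_def)
  have bound: "cover_measure (coarea_gauge f k m \<delta>) E \<le> ennreal (Q * \<epsilon> * M)"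
    if \<epsilon>: "0 < \<epsilon>" "\<epsilon> \<le> 1" for \<epsilon>
    unfolding M_def
  proof (rule cover_measure_le_volume)
    show "0 < V / (5 * K * m / \<epsilon>) ^ (m - 1)"
      using V K m \<epsilon> by simp
    show "\<exists>\<rho>>0. \<forall>r. 0 < r \<and> r < \<rho> \<longrightarrow>
      (\<exists>S. closed S \<and> S \<subseteq> cball x r \<and>
           V / (5 * K * m / \<epsilon>) ^ (m - 1) * r ^ DIM('a) \<le> measure lebesgue S \<and>
           cover_measure (coarea_gauge f k m \<delta>) (S \<inter> E) \<le> ennreal (Q * \<epsilon> * measure lebesgue S))"
      if xE: "x \<in> E" for x
    proof -
      obtain \<sigma> where \<sigma>: "has_approx_metric_derivative f A x \<sigma>" "seminorm_rank \<sigma> < m"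
        "\<And>v. \<sigma> v \<le> K * norm v"
        using crit[OF xE] by blast
      show ?thesis
        unfolding V_def Q_def
        by (rule critical_slab[OF f dim m \<delta> _ \<sigma> K \<epsilon> E(1)]) (use xE E in blast)
    qed
    show "cover_measure (coarea_gauge f k m \<delta>) E'
        \<le> ennreal (10 ^ k * (10 * L) ^ m / unit_ball_vol (real DIM('a)) * measure lebesgue G)"
      if "E' \<subseteq> E" "open G" "E' \<subseteq> G" "G \<in> lmeasurable" for E' and G :: "'a set"
    proof -
      have "0 \<le> 10 ^ k * (10 * L) ^ m / unit_ball_vol (real DIM('a))"
        using lipschitz_on_nonneg[OF f] by simp
      moreover have "emeasure lebesgue G = ennreal (measure lebesgue G)"
        using that(4) by (simp add: emeasure_eq_measure2)
      ultimately show ?thesis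
        using coarea_cover_le_volume[OF f dim \<delta> _ that(3,2)] that(1) E(1)
        by (simp only: ennreal_mult')
    qed
  qed (use \<epsilon> Q E in auto)
  show ?thesis
  proof (rule ennreal_zeroI_small)
    show "0 \<le> Q * M"
      using Q M by simp
    fix e :: real assume e: "0 < e"
    have "cover_measure (coarea_gauge f k m \<delta>) E \<le> ennreal (Q * min e 1 * M)"
      using e by (intro bound) auto
    also have "\<dots> \<le> ennreal (Q * e * M)"
      using Q M by (intro ennreal_leI mult_right_mono mult_left_mono) auto
    finally show "cover_measure (coarea_gauge f k m \<delta>) E \<le> ennreal (Q * M * e)"
      by (simp only: mult_ac)
  qed
qed

theorem theorem8p5:
  fixes A :: "(real ^ 'n) set"
    and f :: "real ^ 'n \<Rightarrow> 'b::metric_space"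
    and m :: nat
  assumes "m \<le> CARD('n)"
    and "A \<in> sets lebesgue"
    and "\<exists>L. L-lipschitz_on A f"
  shows "hausdorff_measure (real m)
           {z. hausdorff_measure (real CARD('n) - real m) (f -` {z} \<inter> Crit m f A) \<noteq> 0} = 0"
proof (cases "m = 0")
  case True
  then show ?thesis
    by (simp add: Crit_def hausdorff_measure_empty)
next
  case False
  then have m: "0 < m"
    by simp
  define k where "k = CARD('n) - m"
  have k: "real CARD('n) - real m = real k" and dim: "DIM(real ^ 'n) = k + m"
    using assms(1) by (auto simp: k_def)
  obtain L where f: "L-lipschitz_on A f"
    using assms(3) by blast
  \<comment> \<open>A common bound for the derivatives on each piece makes the slab constants uniform there.\<close>
  define E where "E j = {x \<in> A \<inter> ball 0 (real (Suc j)). \<exists>\<sigma>. has_approx_metric_derivative f A x \<sigma> \<and>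
      seminorm_rank \<sigma> < m \<and> (\<forall>v. \<sigma> v \<le> real (Suc j) * norm v)}" for j
  have "Crit m f A \<subseteq> (\<Union>j. E j)"
  proof
    fix x assume "x \<in> Crit m f A"
    then obtain \<sigma> where x: "x \<in> A" and \<sigma>: "has_approx_metric_derivative f A x \<sigma>"
      and rank: "seminorm_rank (approx_metric_derivative f A x) < m"
      by (auto simp: Crit_def approx_metrically_differentiable_def)
    have eq: "approx_metric_derivative f A x = \<sigma>"
      by (rule approx_metric_derivative_eqI[OF f x \<sigma>])
    obtain K where K: "0 \<le> K" "\<And>v. \<sigma> v \<le> K * norm v"
      using \<sigma> seminorm_le_norm[of \<sigma>] unfolding has_approx_metric_derivative_def by blast
    obtain j where j: "max K (norm x) < real j"
      using reals_Archimedean2 by blast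
    have "\<sigma> v \<le> real (Suc j) * norm v" for v
    proof -
      have "K * norm v \<le> real (Suc j) * norm v"
        using j by (intro mult_right_mono) auto
      then show ?thesis
        using K(2)[of v] by simp
    qed
    then have "x \<in> E j"
      using x \<sigma> rank j by (auto simp: E_def eq)
    then show "x \<in> (\<Union>j. E j)"
      by blast
  qed
  then have sub: "f -` {z} \<inter> Crit m f A \<subseteq> (\<Union>j. f -` {z} \<inter> E j)" for z
    by blast
  have "hausdorff_measure (real m) (\<Union>j. {z. hausdorff_measure (real k) (f -` {z} \<inter> E j) \<noteq> 0}) = 0"
  proof (intro hausdorff_measure_UN_null coarea_null_imp_fibers_null m)
    fix j and \<delta> :: real assume "0 < \<delta>"
    then show "cover_measure (coarea_gauge f k m \<delta>) (E j) = 0"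
      by (intro critical_coarea_null[OF f dim m, of _ _ "real (Suc j)" "real (Suc j)"])
        (auto simp: E_def)
  qed
  moreover have "{z. hausdorff_measure (real k) (f -` {z} \<inter> Crit m f A) \<noteq> 0}
      \<subseteq> (\<Union>j. {z. hausdorff_measure (real k) (f -` {z} \<inter> E j) \<noteq> 0})"
  proof (rule subsetI, rule ccontr)
    fix z assume "z \<in> {z. hausdorff_measure (real k) (f -` {z} \<inter> Crit m f A) \<noteq> 0}"
      and "z \<notin> (\<Union>j. {z. hausdorff_measure (real k) (f -` {z} \<inter> E j) \<noteq> 0})"
    then show False
      using hausdorff_measure_null_subset[OF hausdorff_measure_UN_null sub] by simp
  qed
  ultimately show ?thesis
    unfolding k by (rule hausdorff_measure_null_subset)
qed

end
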